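(* For every integer $n\ge 1$, the quantum Pfaffian of $Z=(z^L_{i,j})_{1\le i,j\le 2n}$ equals the quantum determinant of $X=(x_{ij})_{1\le i,j\le 2n}$: $$\mathrm{Pf}_q(Z)=\det\nolimits_q(X)\quad\text{in } A_q(X).$$
   Context: $q$ is a nonzero complex number which is either $1$ or not a root of unity, with a fixed square root $q^{1/2}$. $A_q(X)$ is the noncommutative $\mathbb C$-algebra generated by $x_{ij}$, $1\le i,j\le 2n$, with relations, for $i<j$ and $k<l$: $x_{ik}x_{jk}=q\,x_{jk}x_{ik}$, $x_{ki}x_{kj}=q\,x_{kj}x_{ki}$, $x_{il}x_{jk}=x_{jk}x_{il}$, $x_{ik}x_{jl}-x_{jl}x_{ik}=(q-q^{-1})x_{il}x_{jk}$. For a permutation $\sigma$, $l(\sigma)$ is the number of inversions (pairs $i<j$ with $\sigma(i)>\sigma(j)$). The quantum determinant is $\det_q(X)=\sum_{\sigma\in\mathfrak S_{2n}}(-q)^{l(\sigma)}x_{1\sigma(1)}x_{2\sigma(2)}\cdots x_{2n,\sigma(2n)}$. For $1\le i,j\le 2n$ put $z^L_{i,j}=\sum_{k=1}^{n}q^{(i+j+1-4k)/2}\left(x_{i,2k-1}x_{j,2k}-q\,x_{i,2k}x_{j,2k-1}\right)$. Let $\Pi$ be the set of all ordered $2$-partitions $\pi=(i_1,j_1)(i_2,j_2)\cdots(i_n,j_n)$ of $\{1,\dots,2n\}$ into $n$ pairs, written so that $i_k<j_k$ for all $k$ and $i_k<i_{k+1}$ for all $k<n$. Let $l(\pi)$ be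 the number of inversions of the permutation of $\{1,\dots,2n\}$ sending $1,2,3,4,\dots,2n-1,2n$ to $i_1,j_1,i_2,j_2,\dots,i_n,j_n$. The quantum Pfaffian is $$\mathrm{Pf}_q(Z)=\sum_{\pi\in\Pi}(-q)^{l(\pi)}z^L_{i_1,j_1}z^L_{i_2,j_2}\cdots z^L_{i_n,j_n}.$$ *)

theory Defs
  imports
    Complex_Main
    "HOL-Library.Poly_Mapping"
    "HOL-Combinatorics.Permutations"
    "HOL-Algebra.QuotRing"
    "HOL-Algebra.Module"
begin

section \<open>The free associative complex algebra on a set\<close>

text \<open>
  Finitely supported functions \<open>'k \<Rightarrow>\<^sub>0 complex\<close> on an additively written monoid \<open>'k\<close> multiply
  by convolution. Taking words under concatenation for \<open>'k\<close> gives noncommutative polynomials.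
\<close>

datatype 'v word = Word (letters: "'v list")

instantiation word :: (type) monoid_add
begin
definition zero_word :: "'a word" where "0 = Word []"
definition plus_word :: "'a word \<Rightarrow> 'a word \<Rightarrow> 'a word" where
  "u + v = Word (letters u @ letters v)"
instance by standard (simp_all add: zero_word_def plus_word_def)
end

type_synonym 'v ncpoly = "'v word \<Rightarrow>\<^sub>0 complex"

definition var :: "'v \<Rightarrow> 'v ncpoly" where
  "var v = Poly_Mapping.single (Word [v]) 1"

definition const :: "complex \<Rightarrow> 'v ncpoly" where
  "const c = Poly_Mapping.single 0 c"

definition free_algebra :: "'v set \<Rightarrow> (complex, 'v ncpoly) module" where
  "free_algebra V =
    \<lparr>carrier = {p. \<forall>w \<in> Poly_Mapping.keys p. set (letters w) \<subseteq> V},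
     mult = (*), one = 1, zero = 0, add = (+), smult = (\<lambda>c p. const c * p)\<rparr>"

lemma ring_free_algebra: "ring (free_algebra V)"
proof -
  define S :: "'a ncpoly set" where
    "S = {p. \<forall>w \<in> Poly_Mapping.keys p. set (letters w) \<subseteq> V}"
  have F: "free_algebra V =
    \<lparr>carrier = S, mult = (*), one = 1, zero = 0, add = (+), smult = (\<lambda>c p. const c * p)\<rparr>"
    by (simp only: free_algebra_def S_def)
  have add: "p + r \<in> S" if "p \<in> S" "r \<in> S" for p r
    using that Poly_Mapping.keys_add[of p r] unfolding S_def by blast
  have mult: "p * r \<in> S" if "p \<in> S" "r \<in> S" for p r
  proof -
    have "set (letters w) \<subseteq> V" if w: "w \<in> Poly_Mapping.keys (p * r)" for w
    proof -
      obtain u v where "w = u + v" "u \<in> Poly_Mapping.keys p" "v \<in> Poly_Mapping.keys r"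
        using keys_mult w by blast
      then show ?thesis
        using \<open>p \<in> S\<close> \<open>r \<in> S\<close> unfolding S_def by (simp add: plus_word_def)
    qed
    then show ?thesis unfolding S_def by blast
  qed
  have uminus: "- p \<in> S" if "p \<in> S" for p
    using that unfolding S_def by simp
  have zero: "0 \<in> S" and one: "1 \<in> S"
    unfolding S_def by (simp_all add: zero_word_def)
  have "abelian_group (free_algebra V)"
  proof (rule abelian_groupI)
    fix p assume "p \<in> carrier (free_algebra V)"
    then have "- p \<in> carrier (free_algebra V)" "- p \<oplus>\<^bsub>free_algebra V\<^esub> p = \<zero>\<^bsub>free_algebra V\<^esub>"
      using uminus by (simp_all add: F)
    then show "\<exists>r \<in> carrier (free_algebra V). r \<oplus>\<^bsub>free_algebra V\<^esub> p = \<zero>\<^bsub>free_algebra V\<^esub>"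
      by blast
  qed (simp_all add: F add zero ac_simps)
  moreover have "Group.monoid (free_algebra V)"
    by (rule monoidI) (simp_all add: F mult one mult.assoc)
  ultimately show ?thesis
    by (rule ringI) (simp_all add: F distrib_left distrib_right)
qed

section \<open>Quotient of an algebra by an ideal\<close>

text \<open>The library's quotient ring, with the scalar multiplication \<open>c \<odot> (I + a) = I + c \<odot> a\<close>.\<close>

definition quotient_algebra :: "('c, 'a) module \<Rightarrow> 'a set \<Rightarrow> ('c, 'a set) module" where
  "quotient_algebra A I =
    ring.extend (A Quot I) (module.fields (\<lambda>c X. \<Union>a\<in>X. I +>\<^bsub>A\<^esub> (c \<odot>\<^bsub>A\<^esub> a)))"

section \<open>The algebra of quantum matrices\<close>

type_synonym qmat = "(nat \<times> nat) ncpoly set"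

definition quantum_matrix_relators :: "nat \<Rightarrow> complex \<Rightarrow> (nat \<times> nat) ncpoly set" where
  "quantum_matrix_relators N q =
    (let x = (\<lambda>i j. var (i, j)) in
      {x i k * x j k - const q * x j k * x i k | i j k.
         i \<in> {1..N} \<and> j \<in> {1..N} \<and> k \<in> {1..N} \<and> i < j} \<union>
      {x k i * x k j - const q * x k j * x k i | i j k.
         i \<in> {1..N} \<and> j \<in> {1..N} \<and> k \<in> {1..N} \<and> i < j} \<union>
      {x i l * x j k - x j k * x i l | i j k l.
         i \<in> {1..N} \<and> j \<in> {1..N} \<and> k \<in> {1..N} \<and> l \<in> {1..N} \<and> i < j \<and> k < l} \<union>
      {x i k * x j l - x j l * x i k - const (q - inverse q) * x i l * x j k | i j k l.
         i \<in> {1..N} \<and> j \<in> {1..N} \<and> k \<in> {1..N} \<and> l \<in> {1..N} \<and> i < j \<and> k < l})"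

text \<open>Ideals in \<open>HOL-Algebra\<close>, and hence the ideal \<open>Idl\<close> generated by a set, are two-sided.\<close>

definition quantum_matrix_ideal :: "nat \<Rightarrow> complex \<Rightarrow> (nat \<times> nat) ncpoly set" where
  "quantum_matrix_ideal N q =
    Idl\<^bsub>free_algebra ({1..N} \<times> {1..N})\<^esub> (quantum_matrix_relators N q)"

definition quantum_matrix_algebra :: "nat \<Rightarrow> complex \<Rightarrow> (complex, qmat) module" where
  "quantum_matrix_algebra N q =
    quotient_algebra (free_algebra ({1..N} \<times> {1..N})) (quantum_matrix_ideal N q)"

definition quantum_matrix_gen :: "nat \<Rightarrow> complex \<Rightarrow> nat \<Rightarrow> nat \<Rightarrow> qmat" where
  "quantum_matrix_gen N q i j =
    quantum_matrix_ideal N q +>\<^bsub>free_algebra ({1..N} \<times> {1..N})\<^esub> var (i, j)"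

section \<open>Quantum determinant and quantum Pfaffian\<close>

text \<open>
  In this section \<open>A\<close> is a not necessarily commutative complex algebra. The commutative
  \<open>HOL-Algebra\<close> product \<open>\<Otimes>\<close> does not apply, so ordered products are taken over lists.
\<close>

definition list_prod :: "('a, 'm) ring_scheme \<Rightarrow> 'a list \<Rightarrow> 'a" where
  "list_prod A xs = foldr (\<otimes>\<^bsub>A\<^esub>) xs \<one>\<^bsub>A\<^esub>"

definition inversions :: "nat \<Rightarrow> (nat \<Rightarrow> nat) \<Rightarrow> nat" where
  "inversions N \<sigma> = card {(i, j). i \<in> {1..N} \<and> j \<in> {1..N} \<and> i < j \<and> \<sigma> i > \<sigma> j}"

definition quantum_det ::
  "(complex, 'a) module \<Rightarrow> nat \<Rightarrow> complex \<Rightarrow> (nat \<Rightarrow> nat \<Rightarrow> 'a) \<Rightarrow> 'a" where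
  "quantum_det A N q x =
    (\<Oplus>\<^bsub>A\<^esub>\<sigma> \<in> {\<sigma>. \<sigma> permutes {1..N}}.
      (- q) ^ inversions N \<sigma> \<odot>\<^bsub>A\<^esub> list_prod A (map (\<lambda>i. x i (\<sigma> i)) [1..<N + 1]))"

text \<open>Ordered 2-partitions of \<open>{1..2 * n}\<close>, as lists of pairs.\<close>

definition flatten_pairs :: "('a \<times> 'a) list \<Rightarrow> 'a list" where
  "flatten_pairs \<pi> = concat (map (\<lambda>(i, j). [i, j]) \<pi>)"

definition two_partitions :: "nat \<Rightarrow> (nat \<times> nat) list set" where
  "two_partitions n =
    {\<pi>. length \<pi> = n \<and> distinct (flatten_pairs \<pi>) \<and> set (flatten_pairs \<pi>) = {1..2 * n} \<and>
        (\<forall>(i, j) \<in> set \<pi>. i < j) \<and> sorted_wrt (<) (map fst \<pi>)}"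

definition partition_perm :: "(nat \<times> nat) list \<Rightarrow> nat \<Rightarrow> nat" where
  "partition_perm \<pi> m = flatten_pairs \<pi> ! (m - 1)"

definition quantum_pfaffian ::
  "(complex, 'a) module \<Rightarrow> nat \<Rightarrow> complex \<Rightarrow> (nat \<Rightarrow> nat \<Rightarrow> 'a) \<Rightarrow> 'a" where
  "quantum_pfaffian A n q z =
    (\<Oplus>\<^bsub>A\<^esub>\<pi> \<in> two_partitions n.
      (- q) ^ inversions (2 * n) (partition_perm \<pi>) \<odot>\<^bsub>A\<^esub>
        list_prod A (map (\<lambda>(i, j). z i j) \<pi>))"

text \<open>The entries \<open>z\<^sup>L\<close>; the parameter \<open>s\<close> is the square root of \<open>q\<close>.\<close>

definition zL ::
  "(complex, 'a) module \<Rightarrow> nat \<Rightarrow> complex \<Rightarrow> complex \<Rightarrow> (nat \<Rightarrow> nat \<Rightarrow> 'a) \<Rightarrow> nat \<Rightarrow> nat \<Rightarrow> 'a"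
  where
  "zL A n q s x i j =
    (\<Oplus>\<^bsub>A\<^esub>k \<in> {1..n}.
      (s powi (int i + int j + 1 - 4 * int k)) \<odot>\<^bsub>A\<^esub>
        (x i (2 * k - 1) \<otimes>\<^bsub>A\<^esub> x j (2 * k) \<ominus>\<^bsub>A\<^esub>
          q \<odot>\<^bsub>A\<^esub> (x i (2 * k) \<otimes>\<^bsub>A\<^esub> x j (2 * k - 1))))"

end

theory Submission
  imports Defs "HOL-Combinatorics.Multiset_Permutations"
begin

text \<open>
  Both sides obey a recursion in the first row. A pairing of a set of rows pairs its least element \<open>i\<close>
  with some \<open>j\<close>, which expands the Pfaffian into terms \<open>z i j\<close> times a Pfaffian with the rows \<open>i\<close> and
  \<open>j\<close> removed (\<open>free_pfaffian_insert\<close>), and a quantum minor is expanded along its first row by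
  definition (\<open>free_minor\<close>).

  The induction needs a statement for smaller sets of rows, and for these all choices of columns
  occur: the Pfaffian on \<open>2 * m\<close> rows is, up to a power of \<open>s\<close> that depends only on the rows, the sum over
  the \<open>m\<close>-element sets \<open>K\<close> of column pairs \<open>{2 * k - 1, 2 * k}\<close> of the quantum minor on the columns in
  \<open>K\<close>, weighted by the product of the \<open>q ^ (- 2 * k)\<close> (\<open>free_pfaffian_cong\<close>). In the induction step
  \<open>z i j\<close> contributes \<open>2 \<times> 2\<close> minors \<open>x i (2 * k - 1) * x j (2 * k) - q * x i (2 * k) * x j (2 * k - 1)\<close>.
  For fixed \<open>k\<close> and fixed entry of row \<open>i\<close>, the sum over \<open>j\<close> is a Laplace expansion along a column
  \<open>c\<close>. It vanishes if \<open>c\<close> is already a column of the smaller minor, so no column pair is used twice;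
  otherwise it gives a minor with the additional column \<open>c\<close>, and the entries of row \<open>i\<close> that are left
  in front assemble the expansion of the larger minor along its first row (\<open>block_minor_expansion\<close>).
  For all \<open>2 * n\<close> rows only \<open>K = {1..n}\<close> remains, and there the powers of \<open>s\<close> and \<open>q\<close> cancel.

  The relations of the quantum matrix algebra enter only through the expansion along a column
  (\<open>column_expansion\<close>), which is an induction on the rows: expanding all minors along the first row
  \<open>i\<close>, one moves \<open>x j c\<close> to the right past \<open>x i d\<close>, and the correction terms
  \<open>(q - inverse q) * x i c * x j d\<close> for \<open>d < c\<close> form a telescoping sum.

  All this happens between representatives in the free algebra, modulo the defining ideal; the
  coset map then carries the resulting congruence to an equality of cosets.
\<close>

section \<open>Positions in a finite set\<close>

definition below :: "nat set \<Rightarrow> nat \<Rightarrow> nat" where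
  "below C c = card {d \<in> C. d < c}"

lemma below_less_eq_0: "(\<And>d. d \<in> C \<Longrightarrow> c \<le> d) \<Longrightarrow> below C c = 0"
  by (auto simp: below_def not_less[symmetric])

lemma below_self [simp]: "below (C - {c}) c = below C c" "below (insert c C) c = below C c"
  by (auto simp: below_def intro: arg_cong[where f = card])

lemma below_insert:
  "finite C \<Longrightarrow> c \<notin> C \<Longrightarrow> below (insert c C) d = below C d + (if c < d then 1 else 0)"
proof -
  assume "finite C" "c \<notin> C"
  moreover have "{e \<in> insert c C. e < d} = (if c < d then insert c {e \<in> C. e < d} else {e \<in> C. e < d})"
    by auto
  ultimately show ?thesis by (simp add: below_def)
qed

lemma below_remove:
  "finite C \<Longrightarrow> c \<in> C \<Longrightarrow> below C d = below (C - {c}) d + (if c < d then 1 else 0)"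
  using below_insert[of "C - {c}" c d] by (simp add: insert_absorb)

lemma bij_betw_below:
  assumes "finite C"
  shows "bij_betw (below C) {d \<in> C. d < c} {..<below C c}"
proof -
  have less: "below C d < below C e" if "d \<in> C" "d < e" for d e
    unfolding below_def using assms that by (intro psubset_card_mono) auto
  have inj: "inj_on (below C) {d \<in> C. d < c}"
    by (rule linorder_inj_onI) (use less in auto, fastforce)
  moreover have "below C ` {d \<in> C. d < c} = {..<below C c}"
    using less by (intro card_subset_eq) (auto simp: card_image[OF inj], simp add: below_def)
  ultimately show ?thesis by (simp add: bij_betw_def)
qed

text \<open>
  As \<open>d\<close> runs through the elements of \<open>C\<close> below \<open>c\<close>, its position runs through \<open>0, \<dots>, below C c - 1\<close>.
\<close>

lemma sum_below_telescope:
  fixes f :: "nat \<Rightarrow> 'a::ab_group_add"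
  assumes "finite C"
  shows "(\<Sum>d | d \<in> C \<and> d < c. f (Suc (below C d)) - f (below C d)) = f (below C c) - f 0"
  using sum.reindex_bij_betw[OF bij_betw_below[OF assms], of "\<lambda>p. f (Suc p) - f p" c]
  by (simp add: sum_lessThan_telescope)

section \<open>Inversions, pairings and permutations as lists\<close>

text \<open>
  Counting inversions from the head of a list makes them compatible with the recursions below. The
  count agrees with the usual one for lists without repetitions.
\<close>

primrec list_inversions :: "nat list \<Rightarrow> nat" where
  "list_inversions [] = 0"
| "list_inversions (c # cs) = below (set cs) c + list_inversions cs"

text \<open>
  The inversions that involve the first position are counted by \<open>below\<close>; all others are inversions
  of the sequence shifted by one.
\<close>

lemma inversions_eq_list_inversions:
  assumes "distinct xs" and "\<And>i. i \<in> {1..length xs} \<Longrightarrow> \<sigma> i = xs ! (i - 1)"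
  shows "inversions (length xs) \<sigma> = list_inversions xs"
  using assms
proof (induction xs arbitrary: \<sigma>)
  case Nil
  then show ?case by (simp add: inversions_def)
next
  case (Cons c cs)
  let ?m = "length cs"
  let ?first = "{j \<in> {1..?m}. cs ! (j - 1) < c}"
  let ?rest = "{(i, j). i \<in> {1..?m} \<and> j \<in> {1..?m} \<and> i < j \<and> (\<sigma> \<circ> Suc) i > (\<sigma> \<circ> Suc) j}"
  have s1: "\<sigma> 1 = c" using Cons.prems(2)[of 1] by simp
  have sS: "\<sigma> (Suc j) = cs ! (j - 1)" if "j \<in> {1..?m}" for j
    using Cons.prems(2)[of "Suc j"] that by (cases j) auto
  have split: "{(i, j). i \<in> {1..Suc ?m} \<and> j \<in> {1..Suc ?m} \<and> i < j \<and> \<sigma> i > \<sigma> j}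
      = (\<lambda>j. (1, Suc j)) ` ?first \<union> map_prod Suc Suc ` ?rest" (is "?L = ?R")
  proof (intro equalityI subsetI)
    fix p assume "p \<in> ?L"
    then obtain i j where p: "p = (i, j)" "i \<in> {1..Suc ?m}" "j \<in> {1..Suc ?m}" "i < j" "\<sigma> i > \<sigma> j"
      by blast
    then obtain j' where j': "j = Suc j'" "j' \<in> {1..?m}" by (cases j) auto
    show "p \<in> ?R"
    proof (cases "i = 1")
      case True
      then have "j' \<in> ?first" using p j' s1 sS[of j'] by simp
      then show ?thesis using p j' True by blast
    next
      case False
      then obtain i' where i': "i = Suc i'" "i' \<in> {1..?m}" using p by (cases i) auto
      have "(i', j') \<in> ?rest" using p i' j' by simp
      then have "map_prod Suc Suc (i', j') \<in> map_prod Suc Suc ` ?rest" by (rule imageI)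
      then show ?thesis using p i' j' by simp
    qed
  next
    fix p assume "p \<in> ?R"
    then show "p \<in> ?L" using s1 sS by auto
  qed
  have fin: "finite ?rest"
    by (rule finite_subset[of _ "{1..?m} \<times> {1..?m}"]) auto
  have "card ?L = card ((\<lambda>j. (1::nat, Suc j)) ` ?first) + card (map_prod Suc Suc ` ?rest)"
    unfolding split using fin by (intro card_Un_disjoint) auto
  also have "card ((\<lambda>j. (1::nat, Suc j)) ` ?first) = card ?first"
    by (rule card_image) (auto simp: inj_on_def)
  also have "card ?first = below (set cs) c"
    unfolding below_def
  proof (rule bij_betw_same_card[of "\<lambda>j. cs ! (j - 1)"])
    have "bij_betw ((!) cs) {..<?m} (set cs)"
      using Cons.prems(1) by (intro bij_betw_nth) auto
    moreover have "bij_betw (\<lambda>j. j - 1) {1..?m} {..<?m}"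
      by (rule bij_betw_byWitness[of _ Suc]) auto
    ultimately have b: "bij_betw ((!) cs \<circ> (\<lambda>j. j - 1)) {1..?m} (set cs)"
      by (blast intro: bij_betw_trans)
    let ?f = "\<lambda>j. cs ! (j - 1)"
    have im: "?f ` {1..?m} = set cs" and inj: "inj_on ?f {1..?m}"
      using b by (simp_all add: bij_betw_def comp_def)
    have "?f ` ?first = {d \<in> set cs. d < c}"
      unfolding im[symmetric] by blast
    moreover have "inj_on ?f ?first"
      using inj by (rule inj_on_subset) blast
    ultimately show "bij_betw ?f ?first {d \<in> set cs. d < c}"
      by (simp add: bij_betw_def)
  qed
  also have "card (map_prod Suc Suc ` ?rest) = card ?rest"
    by (rule card_image) (auto simp: inj_on_def)
  also have "card ?rest = inversions ?m (\<sigma> \<circ> Suc)"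
    by (simp add: inversions_def)
  also have "\<dots> = list_inversions cs"
    using Cons.prems(1) sS by (intro Cons.IH) auto
  finally show ?case by (simp add: inversions_def)
qed

text \<open>
  Ordered 2-partitions of an arbitrary set, so that one can pass from a set to a subset.
\<close>

definition pairings :: "nat set \<Rightarrow> (nat \<times> nat) list set" where
  "pairings I =
    {\<pi>. distinct (flatten_pairs \<pi>) \<and> set (flatten_pairs \<pi>) = I \<and>
        (\<forall>(i, j) \<in> set \<pi>. i < j) \<and> sorted_wrt (<) (map fst \<pi>)}"

lemma flatten_pairs_simps [simp]:
  "flatten_pairs [] = []" "flatten_pairs ((i, j) # \<pi>) = i # j # flatten_pairs \<pi>"
  by (simp_all add: flatten_pairs_def)

lemma length_flatten_pairs: "length (flatten_pairs \<pi>) = 2 * length \<pi>"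
  by (induction \<pi>) auto

lemma two_partitions_eq_pairings: "two_partitions n = pairings {1..2 * n}"
proof -
  have "length \<pi> = n" if "distinct (flatten_pairs \<pi>)" "set (flatten_pairs \<pi>) = {1..2 * n}" for \<pi>
    using distinct_card[OF that(1)] that(2) by (simp add: length_flatten_pairs)
  then show ?thesis unfolding two_partitions_def pairings_def by blast
qed

lemma pairings_empty: "pairings {} = {[]}"
proof -
  have "\<pi> = []" if "set (flatten_pairs \<pi>) = {}" for \<pi> :: "(nat \<times> nat) list"
    using that by (cases \<pi>) auto
  then show ?thesis by (auto simp: pairings_def)
qed

lemma set_pairs_subset_flatten_pairs:
  "set \<pi> \<subseteq> set (flatten_pairs \<pi>) \<times> set (flatten_pairs \<pi>)"
  by (induction \<pi>) auto

lemma flatten_pairs_gt: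
  fixes \<pi> :: "(nat \<times> nat) list"
  assumes "\<forall>(i, j) \<in> set \<pi>. i < j" "\<forall>p \<in> set \<pi>. a < fst p" "b \<in> set (flatten_pairs \<pi>)"
  shows "a < b"
proof -
  obtain i j where ij: "(i, j) \<in> set \<pi>" "b = i \<or> b = j"
    using assms(3) by (auto simp: flatten_pairs_def)
  moreover have "i < j" "a < i"
    using assms(1,2) ij(1) by auto
  ultimately show ?thesis by (auto intro: less_trans)
qed

text \<open>
  The least element of the set opens the first pair, because first components increase and each is
  smaller than its partner.
\<close>

lemma pairings_insert:
  assumes "\<And>j. j \<in> J \<Longrightarrow> i < j"
  shows "pairings (insert i J) = (\<Union>j\<in>J. (#) (i, j) ` pairings (J - {j}))"
proof (intro equalityI subsetI)
  fix \<pi> assume \<pi>: "\<pi> \<in> pairings (insert i J)"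
  then obtain a b \<rho> where eq: "\<pi> = (a, b) # \<rho>"
    by (cases \<pi>) (auto simp: pairings_def)
  have gt: "a < c" if "c \<in> set (flatten_pairs \<rho>)" for c
    using \<pi> that by (intro flatten_pairs_gt[of \<rho>]) (auto simp: eq pairings_def)
  have ab: "a < b" "a \<in> insert i J" "i \<in> {a, b} \<union> set (flatten_pairs \<rho>)"
    using \<pi> by (auto simp: eq pairings_def)
  have "a = i" using assms gt ab by fastforce
  moreover have b: "b \<in> J" using \<pi> ab \<open>a = i\<close> by (auto simp: eq pairings_def)
  moreover have "set (flatten_pairs \<rho>) = J - {b}"
  proof -
    have "insert a (insert b (set (flatten_pairs \<rho>))) = insert i J"
      "a \<notin> set (flatten_pairs \<rho>)" "b \<notin> set (flatten_pairs \<rho>)" "i \<notin> J" "a \<noteq> b"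
      using \<pi> assms by (auto simp: eq pairings_def)
    then have "insert b (set (flatten_pairs \<rho>)) = J"
      using \<open>a = i\<close> by (simp add: insert_ident)
    then show ?thesis using \<open>b \<notin> set (flatten_pairs \<rho>)\<close> by blast
  qed
  ultimately show "\<pi> \<in> (\<Union>j\<in>J. (#) (i, j) ` pairings (J - {j}))"
    using \<pi> by (auto simp: eq pairings_def)
next
  fix \<pi> assume "\<pi> \<in> (\<Union>j\<in>J. (#) (i, j) ` pairings (J - {j}))"
  then obtain j \<rho> where "j \<in> J" "\<pi> = (i, j) # \<rho>" "\<rho> \<in> pairings (J - {j})" by blast
  moreover have "i < fst p" if "p \<in> set \<rho>" for p
    using set_pairs_subset_flatten_pairs[of \<rho>] that calculation assms by (auto simp: pairings_def)
  ultimately show "\<pi> \<in> pairings (insert i J)"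
    using assms by (auto simp: pairings_def)
qed

lemma finite_pairings: "finite I \<Longrightarrow> finite (pairings I)"
proof (rule finite_subset)
  assume "finite I"
  have "set \<pi> \<subseteq> I \<times> I" if "set (flatten_pairs \<pi>) = I" for \<pi>
    using set_pairs_subset_flatten_pairs[of \<pi>] that by simp
  moreover have "length \<pi> \<le> card I" if "distinct (flatten_pairs \<pi>)" "set (flatten_pairs \<pi>) = I" for \<pi>
    using distinct_card[OF that(1)] that(2) by (simp add: length_flatten_pairs)
  ultimately show "pairings I \<subseteq> {\<pi>. set \<pi> \<subseteq> I \<times> I \<and> length \<pi> \<le> card I}"
    unfolding pairings_def by blast
  show "finite {\<pi>. set \<pi> \<subseteq> I \<times> I \<and> length \<pi> \<le> card I}"
    using \<open>finite I\<close> by (intro finite_lists_length_le) auto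
qed

text \<open>
  One-line notation. Surjectivity follows from injectivity by counting.
\<close>

lemma bij_betw_permutes_permutations_of_set:
  "bij_betw (\<lambda>\<sigma>. map \<sigma> [1..<N + 1]) {\<sigma>. \<sigma> permutes {1..N}} (permutations_of_set {1..N})"
proof -
  let ?f = "\<lambda>\<sigma>. map \<sigma> [1..<N + 1]" and ?P = "{\<sigma>. \<sigma> permutes {1..N}}"
  have set: "set [1..<N + 1] = {1..N}" by auto
  have inj: "inj_on ?f ?P"
  proof (rule inj_onI)
    fix \<sigma> \<tau> assume "\<sigma> \<in> ?P" "\<tau> \<in> ?P" "?f \<sigma> = ?f \<tau>"
    then have "\<sigma> i = \<tau> i" for i
      using set by (cases "i \<in> {1..N}") (auto simp: permutes_def simp del: upt_Suc)
    then show "\<sigma> = \<tau>" by blast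
  qed
  moreover have "?f ` ?P = permutations_of_set {1..N}"
  proof (rule card_subset_eq)
    show "?f ` ?P \<subseteq> permutations_of_set {1..N}"
    proof (intro image_subsetI permutations_of_setI)
      fix \<sigma> assume "\<sigma> \<in> ?P"
      then have p: "\<sigma> permutes {1..N}" by simp
      show "set (?f \<sigma>) = {1..N}"
        unfolding set_map set by (rule permutes_image[OF p])
      show "distinct (?f \<sigma>)"
        unfolding distinct_map set using permutes_inj_on[OF p] by (simp del: upt_Suc)
    qed
    show "card (?f ` ?P) = card (permutations_of_set {1..N})"
      unfolding card_image[OF inj] by (simp add: card_permutations)
  qed simp
  ultimately show ?thesis by (simp add: bij_betw_def)
qed

section \<open>Scalar multiplication of noncommutative polynomials\<close>

text \<open>
  Writing scalars as an operation of their own lets the simplifier collect them at the front of a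
  product without a commutative law for the other factors.
\<close>

definition scale :: "complex \<Rightarrow> 'v ncpoly \<Rightarrow> 'v ncpoly" (infixr "\<bullet>" 75) where
  "c \<bullet> p = const c * p"

lemma const_add: "const (a + b) = const a + const b"
  by (simp add: const_def single_add)

lemma const_mult: "const (a * b) = const a * const b"
  by (simp add: const_def mult_single)

lemma const_commute: "p * const c = const c * p"
proof (induction p rule: update_induct)
  case const
  then show ?case by simp
next
  case (update f a b)
  have "Poly_Mapping.update a b f = f + Poly_Mapping.single a b"
    using update.hyps
    by (intro poly_mapping_eqI)
      (auto simp: lookup_update lookup_add lookup_single when_def in_keys_iff)
  moreover have "Poly_Mapping.single a b * const c = const c * Poly_Mapping.single a b"
    by (simp add: const_def mult_single mult.commute)
  ultimately show ?case
    using update by (simp add: distrib_left distrib_right)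
qed

lemma scale_simps [simp]:
  "a \<bullet> b \<bullet> p = (a * b) \<bullet> p" "1 \<bullet> p = p" "0 \<bullet> p = 0" "a \<bullet> 0 = 0"
  "(a \<bullet> p) * r = a \<bullet> (p * r)" "p * (a \<bullet> r) = a \<bullet> (p * r)"
proof -
  show "p * (a \<bullet> r) = a \<bullet> (p * r)"
    unfolding scale_def by (metis const_commute mult.assoc)
qed (simp_all add: scale_def const_mult mult.assoc, simp_all add: const_def)

lemma scale_add_left: "(a + b) \<bullet> p = a \<bullet> p + b \<bullet> p"
  by (simp add: scale_def const_add distrib_right)

lemma scale_add_right: "a \<bullet> (p + r) = a \<bullet> p + a \<bullet> r"
  by (simp add: scale_def distrib_left)

lemma scale_minus_left: "(- a) \<bullet> p = - (a \<bullet> p)"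
  by (rule minus_unique[symmetric]) (simp flip: scale_add_left)

lemma scale_diff_right: "a \<bullet> (p - r) = a \<bullet> p - a \<bullet> r"
  by (simp add: scale_def right_diff_distrib)

lemma scale_sum_right: "a \<bullet> sum f S = (\<Sum>i\<in>S. a \<bullet> f i)"
  by (simp add: scale_def sum_distrib_left)

lemma scale_sum_left: "sum f S \<bullet> p = (\<Sum>i\<in>S. f i \<bullet> p)"
  by (induction S rule: infinite_finite_induct) (simp_all add: scale_add_left)

section \<open>Recursive forms of the Pfaffian and of minors\<close>

definition free_pfaffian ::
  "complex \<Rightarrow> (nat \<Rightarrow> nat \<Rightarrow> 'v ncpoly) \<Rightarrow> nat set \<Rightarrow> 'v ncpoly" where
  "free_pfaffian q z I = (\<Sum>\<pi>\<in>pairings I.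
     (- q) ^ list_inversions (flatten_pairs \<pi>) \<bullet> prod_list (map (\<lambda>(i, j). z i j) \<pi>))"

lemma free_pfaffian_empty: "free_pfaffian q z {} = 1"
  by (simp add: free_pfaffian_def pairings_empty)

lemma free_pfaffian_insert:
  assumes "finite J" and "\<And>j. j \<in> J \<Longrightarrow> i < j"
  shows "free_pfaffian q z (insert i J) =
    (\<Sum>j\<in>J. (- q) ^ below J j \<bullet> (z i j * free_pfaffian q z (J - {j})))"
proof -
  let ?t = "\<lambda>\<pi>. (- q) ^ list_inversions (flatten_pairs \<pi>) \<bullet> prod_list (map (\<lambda>(i, j). z i j) \<pi>)"
  have pairings: "pairings (insert i J) = (\<Union>j\<in>J. (#) (i, j) ` pairings (J - {j}))"
    using assms(2) by (rule pairings_insert)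
  have "free_pfaffian q z (insert i J) = (\<Sum>j\<in>J. sum ?t ((#) (i, j) ` pairings (J - {j})))"
    unfolding free_pfaffian_def pairings
    by (rule sum.UNION_disjoint) (auto simp: assms(1) finite_pairings)
  also have "\<dots> = (\<Sum>j\<in>J. \<Sum>\<pi>\<in>pairings (J - {j}). ?t ((i, j) # \<pi>))"
    by (simp add: sum.reindex)
  also have "\<dots> = (\<Sum>j\<in>J. (- q) ^ below J j \<bullet> (z i j * free_pfaffian q z (J - {j})))"
  proof (rule sum.cong)
    fix j assume j: "j \<in> J"
    have "?t ((i, j) # \<pi>) = (- q) ^ below J j \<bullet> (z i j * ?t \<pi>)" if "\<pi> \<in> pairings (J - {j})" for \<pi>
    proof -
      have S: "set (flatten_pairs \<pi>) = J - {j}" using that by (simp add: pairings_def)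
      have "below (insert j (J - {j})) i = 0"
        using assms(2) j by (intro below_less_eq_0) (auto intro: less_imp_le)
      then show ?thesis using S by (simp add: power_add)
    qed
    then show "(\<Sum>\<pi>\<in>pairings (J - {j}). ?t ((i, j) # \<pi>)) =
        (- q) ^ below J j \<bullet> (z i j * free_pfaffian q z (J - {j}))"
      unfolding free_pfaffian_def by (simp add: sum_distrib_left scale_sum_right)
  qed simp
  finally show ?thesis .
qed

text \<open>
  The quantum minor with rows \<open>is\<close> and columns \<open>C\<close>. The lists that occur are strictly increasing
  and satisfy \<open>length is = card C\<close>.
\<close>

primrec free_minor ::
  "complex \<Rightarrow> (nat \<Rightarrow> nat \<Rightarrow> 'v ncpoly) \<Rightarrow> nat list \<Rightarrow> nat set \<Rightarrow> 'v ncpoly" where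
  "free_minor q x [] C = 1"
| "free_minor q x (i # is) C =
    (\<Sum>c\<in>C. (- q) ^ below C c \<bullet> (x i c * free_minor q x is (C - {c})))"

lemma free_minor_eq_sum_permutations:
  assumes "finite C" and "card C = length is"
  shows "free_minor q x is C = (\<Sum>cs\<in>permutations_of_set C.
    (- q) ^ list_inversions cs \<bullet> prod_list (map2 x is cs))"
  using assms
proof (induction "is" arbitrary: C)
  case Nil
  then show ?case by simp
next
  case (Cons i "is")
  let ?t = "\<lambda>is cs. (- q) ^ list_inversions cs \<bullet> prod_list (map2 x is cs)"
  have ne: "C \<noteq> {}" using Cons.prems by auto
  have "(\<Sum>cs\<in>permutations_of_set C. ?t (i # is) cs)
      = (\<Sum>c\<in>C. sum (?t (i # is)) ((#) c ` permutations_of_set (C - {c})))"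
    unfolding permutations_of_set_nonempty[OF ne]
    by (rule sum.UNION_disjoint) (auto simp: Cons.prems(1))
  also have "\<dots> = (\<Sum>c\<in>C. \<Sum>cs\<in>permutations_of_set (C - {c}). ?t (i # is) (c # cs))"
    by (simp add: sum.reindex)
  also have "\<dots> = (\<Sum>c\<in>C. (- q) ^ below C c \<bullet> (x i c * free_minor q x is (C - {c})))"
  proof (rule sum.cong)
    fix c assume c: "c \<in> C"
    have "free_minor q x is (C - {c}) = (\<Sum>cs\<in>permutations_of_set (C - {c}). ?t is cs)"
      using Cons.prems c by (intro Cons.IH) auto
    moreover have "?t (i # is) (c # cs) = (- q) ^ below C c \<bullet> (x i c * ?t is cs)"
      if "cs \<in> permutations_of_set (C - {c})" for cs
      using permutations_of_setD(1)[OF that] by (simp add: power_add)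
    ultimately show "(\<Sum>cs\<in>permutations_of_set (C - {c}). ?t (i # is) (c # cs))
        = (- q) ^ below C c \<bullet> (x i c * free_minor q x is (C - {c}))"
      by (simp add: sum_distrib_left scale_sum_right)
  qed simp
  finally show ?case by simp
qed

lemma free_minor_eq_sum_permutes:
  "free_minor q x [1..<N + 1] {1..N} = (\<Sum>\<sigma> | \<sigma> permutes {1..N}.
    (- q) ^ inversions N \<sigma> \<bullet> prod_list (map (\<lambda>i. x i (\<sigma> i)) [1..<N + 1]))"
proof -
  have "free_minor q x [1..<N + 1] {1..N} = (\<Sum>cs\<in>permutations_of_set {1..N}.
    (- q) ^ list_inversions cs \<bullet> prod_list (map2 x [1..<N + 1] cs))"
    by (rule free_minor_eq_sum_permutations) auto
  also have "\<dots> = (\<Sum>\<sigma> | \<sigma> permutes {1..N}.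
    (- q) ^ list_inversions (map \<sigma> [1..<N + 1])
      \<bullet> prod_list (map2 x [1..<N + 1] (map \<sigma> [1..<N + 1])))"
    by (rule sum.reindex_bij_betw[OF bij_betw_permutes_permutations_of_set, symmetric])
  also have "\<dots> = (\<Sum>\<sigma> | \<sigma> permutes {1..N}.
    (- q) ^ inversions N \<sigma> \<bullet> prod_list (map (\<lambda>i. x i (\<sigma> i)) [1..<N + 1]))"
  proof (rule sum.cong)
    fix \<sigma> assume "\<sigma> \<in> {\<sigma>. \<sigma> permutes {1..N}}"
    then have "map \<sigma> [1..<N + 1] \<in> permutations_of_set {1..N}"
      using bij_betw_apply[OF bij_betw_permutes_permutations_of_set] by blast
    then have "distinct (map \<sigma> [1..<N + 1])" by (rule permutations_of_setD)
    then have "inversions (length (map \<sigma> [1..<N + 1])) \<sigma> = list_inversions (map \<sigma> [1..<N + 1])"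
      by (rule inversions_eq_list_inversions) (auto simp del: upt_Suc)
    moreover have "map2 x is (map \<sigma> is) = map (\<lambda>i. x i (\<sigma> i)) is" for "is"
      by (induction "is") auto
    ultimately show "(- q) ^ list_inversions (map \<sigma> [1..<N + 1])
      \<bullet> prod_list (map2 x [1..<N + 1] (map \<sigma> [1..<N + 1]))
      = (- q) ^ inversions N \<sigma> \<bullet> prod_list (map (\<lambda>i. x i (\<sigma> i)) [1..<N + 1])"
      by (simp del: upt_Suc)
  qed simp
  finally show ?thesis .
qed

lemma free_pfaffian_eq_sum_two_partitions:
  "free_pfaffian q z {1..2 * n} = (\<Sum>\<pi>\<in>two_partitions n.
    (- q) ^ inversions (2 * n) (partition_perm \<pi>) \<bullet> prod_list (map (\<lambda>(i, j). z i j) \<pi>))"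
  unfolding free_pfaffian_def two_partitions_eq_pairings
proof (rule sum.cong)
  fix \<pi> assume \<pi>: "\<pi> \<in> pairings {1..2 * n}"
  then have d: "distinct (flatten_pairs \<pi>)" and S: "set (flatten_pairs \<pi>) = {1..2 * n}"
    by (simp_all add: pairings_def)
  have "length (flatten_pairs \<pi>) = 2 * n"
    using distinct_card[OF d] S by simp
  then show "(- q) ^ list_inversions (flatten_pairs \<pi>) \<bullet> prod_list (map (\<lambda>(i, j). z i j) \<pi>) =
      (- q) ^ inversions (2 * n) (partition_perm \<pi>) \<bullet> prod_list (map (\<lambda>(i, j). z i j) \<pi>)"
    using inversions_eq_list_inversions[OF d, of "partition_perm \<pi>"]
    by (simp add: partition_perm_def)
qed simp

section \<open>Sets of pairs of adjacent columns\<close>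

definition block_columns :: "nat set \<Rightarrow> nat set" where
  "block_columns K = (\<Union>k\<in>K. {2 * k - 1, 2 * k})"

lemma card_block_columns:
  assumes "K \<subseteq> {1..n}"
  shows "card (block_columns K) = 2 * card K"
proof -
  have "card (block_columns K) = (\<Sum>k\<in>K. card {2 * k - 1, 2 * k})"
    unfolding block_columns_def
    using assms finite_subset[OF assms] by (intro card_UN_disjoint) fastforce+
  also have "\<dots> = (\<Sum>k\<in>K. 2)"
  proof (rule sum.cong)
    fix k assume "k \<in> K"
    then have "2 * k - 1 \<noteq> 2 * k" using assms by fastforce
    then show "card {2 * k - 1, 2 * k} = 2" by simp
  qed simp
  finally show ?thesis by simp
qed

lemma block_columns_subset: "K \<subseteq> {1..n} \<Longrightarrow> block_columns K \<subseteq> {1..2 * n}"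
  by (fastforce simp: block_columns_def)

lemma block_columns_all: "block_columns {1..n} = {1..2 * n}"
proof
  show "{1..2 * n} \<subseteq> block_columns {1..n}"
  proof
    fix c assume c: "c \<in> {1..2 * n}"
    then have "c = 2 * ((c + 1) div 2) - 1 \<or> c = 2 * ((c + 1) div 2)" "(c + 1) div 2 \<in> {1..n}"
      by auto
    then show "c \<in> block_columns {1..n}" unfolding block_columns_def by blast
  qed
qed (rule block_columns_subset, simp)

lemma in_block_columns_iff:
  assumes "K \<subseteq> {1..n}" "k \<ge> 1"
  shows "2 * k - 1 \<in> block_columns K \<longleftrightarrow> k \<in> K" "2 * k \<in> block_columns K \<longleftrightarrow> k \<in> K"
proof -
  have "2 * k - 1 \<noteq> 2 * k'" "2 * k \<noteq> 2 * k' - 1" "2 * k - 1 = 2 * k' - 1 \<longleftrightarrow> k = k'"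
    if "k' \<in> K" for k'
    using that assms by (auto, presburger+)
  then show "2 * k - 1 \<in> block_columns K \<longleftrightarrow> k \<in> K" "2 * k \<in> block_columns K \<longleftrightarrow> k \<in> K"
    unfolding block_columns_def by auto
qed

text \<open>
  Both sides sum over the sets of \<open>Suc m\<close> elements with a marked element \<open>k\<close>.
\<close>

lemma sum_subsets_insert:
  fixes g :: "nat set \<Rightarrow> nat \<Rightarrow> 'a::comm_monoid_add"
  shows "(\<Sum>K | K \<subseteq> {1..n} \<and> card K = m. \<Sum>k\<in>{1..n} - K. g (insert k K) k)
    = (\<Sum>K | K \<subseteq> {1..n} \<and> card K = Suc m. \<Sum>k\<in>K. g K k)"
proof -
  have fin: "finite K" if "K \<subseteq> {1..n}" for K :: "nat set"
    using that by (rule finite_subset) simp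
  have fin2: "finite {K. K \<subseteq> {1..n} \<and> card K = m}" for m
    by (rule finite_subset[of _ "Pow {1..n}"]) auto
  show ?thesis
    using fin
    by (subst (1 2) sum.Sigma)
      (auto intro!: fin2 sum.reindex_bij_witness[of _ "\<lambda>(K, k). (K - {k}, k)" "\<lambda>(K, k). (insert k K, k)"]
        simp: insert_absorb)
qed

section \<open>Quotient algebras\<close>

text \<open>
  Extending the quotient ring by a scalar multiplication leaves its ring operations unchanged, so
  its additive group is that of the quotient ring.
\<close>

lemma quotient_algebra_ops:
  "carrier (quotient_algebra A I) = carrier (A Quot I)"
  "X \<otimes>\<^bsub>quotient_algebra A I\<^esub> Y = X \<otimes>\<^bsub>A Quot I\<^esub> Y"
  "X \<oplus>\<^bsub>quotient_algebra A I\<^esub> Y = X \<oplus>\<^bsub>A Quot I\<^esub> Y"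
  "\<one>\<^bsub>quotient_algebra A I\<^esub> = \<one>\<^bsub>A Quot I\<^esub>"
  "\<zero>\<^bsub>quotient_algebra A I\<^esub> = \<zero>\<^bsub>A Quot I\<^esub>"
  "c \<odot>\<^bsub>quotient_algebra A I\<^esub> X = (\<Union>a\<in>X. I +>\<^bsub>A\<^esub> (c \<odot>\<^bsub>A\<^esub> a))"
  by (simp_all add: quotient_algebra_def ring.defs module.defs)

lemma abelian_group_quotient_algebra:
  assumes "ring (A Quot I)"
  shows "abelian_group (quotient_algebra A I)"
proof -
  interpret Q: ring "A Quot I" by (rule assms)
  show ?thesis
  proof (rule abelian_groupI, unfold quotient_algebra_ops)
    fix x assume "x \<in> carrier (A Quot I)"
    then show "\<exists>y\<in>carrier (A Quot I). y \<oplus>\<^bsub>A Quot I\<^esub> x = \<zero>\<^bsub>A Quot I\<^esub>"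
      using Q.l_neg by blast
  qed (simp_all add: Q.a_assoc Q.a_comm Q.a_lcomm)
qed

section \<open>Congruence modulo the quantum matrix relations\<close>

locale quantum_matrices =
  fixes N :: nat and q :: complex
  assumes q_nonzero: "q \<noteq> 0"
begin

definition F :: "(complex, (nat \<times> nat) ncpoly) module" where
  "F = free_algebra ({1..N} \<times> {1..N})"

abbreviation x :: "nat \<Rightarrow> nat \<Rightarrow> (nat \<times> nat) ncpoly" where
  "x i j \<equiv> var (i, j)"

sublocale F: ring F
  unfolding F_def by (rule ring_free_algebra)

lemma F_ops:
  "p \<otimes>\<^bsub>F\<^esub> r = p * r" "p \<oplus>\<^bsub>F\<^esub> r = p + r" "\<one>\<^bsub>F\<^esub> = 1" "\<zero>\<^bsub>F\<^esub> = 0" "c \<odot>\<^bsub>F\<^esub> p = c \<bullet> p"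
  by (simp_all add: F_def free_algebra_def scale_def)

lemma mult_closed [intro]: "p \<in> carrier F \<Longrightarrow> r \<in> carrier F \<Longrightarrow> p * r \<in> carrier F"
  using F.m_closed by (simp add: F_ops)

lemma add_closed [intro]: "p \<in> carrier F \<Longrightarrow> r \<in> carrier F \<Longrightarrow> p + r \<in> carrier F"
  using F.a_closed by (simp add: F_ops)

lemma const_closed [intro]: "const c \<in> carrier F"
  by (simp add: F_def free_algebra_def const_def zero_word_def)

lemma scale_closed [intro]: "p \<in> carrier F \<Longrightarrow> c \<bullet> p \<in> carrier F"
  unfolding scale_def by blast

lemma diff_closed [intro]: "p \<in> carrier F \<Longrightarrow> r \<in> carrier F \<Longrightarrow> p - r \<in> carrier F"
  using add_closed[of p "(- 1) \<bullet> r"] scale_closed[of r "- 1"] by (simp add: scale_minus_left)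

lemma one_closed [intro]: "1 \<in> carrier F"
  using F.one_closed by (simp add: F_ops)

lemma sum_closed [intro]: "(\<And>a. a \<in> A \<Longrightarrow> f a \<in> carrier F) \<Longrightarrow> sum f A \<in> carrier F"
  using F.zero_closed
  by (induction A rule: infinite_finite_induct) (auto simp: F_ops)

lemma x_closed: "i \<in> {1..N} \<Longrightarrow> j \<in> {1..N} \<Longrightarrow> x i j \<in> carrier F"
  by (simp add: F_def free_algebra_def var_def)

lemma free_minor_closed:
  "set is \<subseteq> {1..N} \<Longrightarrow> C \<subseteq> {1..N} \<Longrightarrow> free_minor q x is C \<in> carrier F"
proof (induction "is" arbitrary: C)
  case Nil
  then show ?case by auto
next
  case (Cons i "is")
  have "free_minor q x is (C - {c}) \<in> carrier F" for c
    using Cons.prems by (intro Cons.IH) auto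
  then show ?case
    using Cons.prems unfolding free_minor.simps
    by (intro sum_closed scale_closed mult_closed x_closed) auto
qed

lemma relators_subset: "quantum_matrix_relators N q \<subseteq> carrier F"
  unfolding quantum_matrix_relators_def Let_def
  by (auto intro!: diff_closed mult_closed const_closed x_closed)

sublocale J: ideal "quantum_matrix_ideal N q" F
  unfolding quantum_matrix_ideal_def F_def[symmetric] by (rule F.genideal_ideal[OF relators_subset])

text \<open>
  Congruence modulo the defining ideal is compatible with multiplication only by elements of the
  subalgebra \<open>F\<close>, since the ideal is generated inside \<open>F\<close>, which has only the variables \<open>x i j\<close> with \<open>1 \<le> i, j \<le> N\<close>.
\<close>

definition cong :: "(nat \<times> nat) ncpoly \<Rightarrow> (nat \<times> nat) ncpoly \<Rightarrow> bool" (infix "\<approx>" 50) where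
  "p \<approx> r \<longleftrightarrow> p - r \<in> quantum_matrix_ideal N q"

lemma cong_refl [simp]: "p \<approx> p"
  using J.zero_closed by (simp add: cong_def F_ops)

lemma cong_trans [trans]: "p \<approx> r \<Longrightarrow> r \<approx> t \<Longrightarrow> p \<approx> t"
  using J.a_closed[of "p - r" "r - t"] by (simp add: cong_def F_ops)

(* Without these two rules, mixed chains fall back on substitution, whose unification does not end in practice. *)
lemma cong_eq_trans [trans]: "p \<approx> r \<Longrightarrow> r = t \<Longrightarrow> p \<approx> t" "p = r \<Longrightarrow> r \<approx> t \<Longrightarrow> p \<approx> t"
  by simp_all

lemma cong_mult_left: "p \<approx> r \<Longrightarrow> a \<in> carrier F \<Longrightarrow> a * p \<approx> a * r"
  using J.I_l_closed[of "p - r" a] by (simp add: cong_def F_ops right_diff_distrib)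

lemma cong_mult_right: "p \<approx> r \<Longrightarrow> a \<in> carrier F \<Longrightarrow> p * a \<approx> r * a"
  using J.I_r_closed[of "p - r" a] by (simp add: cong_def F_ops left_diff_distrib)

lemma cong_scale: "p \<approx> r \<Longrightarrow> c \<bullet> p \<approx> c \<bullet> r"
  unfolding scale_def using cong_mult_left const_closed by blast

lemma cong_add: "p \<approx> r \<Longrightarrow> p' \<approx> r' \<Longrightarrow> p + p' \<approx> r + r'"
  using J.a_closed[of "p - r" "p' - r'"] by (simp add: cong_def F_ops algebra_simps)

lemma cong_diff: "p \<approx> r \<Longrightarrow> p' \<approx> r' \<Longrightarrow> p - p' \<approx> r - r'"
  using cong_add[of p r "(- 1) \<bullet> p'" "(- 1) \<bullet> r'"] cong_scale[of p' r' "- 1"]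
  by (simp add: scale_minus_left)

lemma cong_sum: "(\<And>a. a \<in> A \<Longrightarrow> f a \<approx> g a) \<Longrightarrow> sum f A \<approx> sum g A"
  by (induction A rule: infinite_finite_induct) (auto intro: cong_add)

lemma relator_cong_0: "p \<in> quantum_matrix_relators N q \<Longrightarrow> p \<approx> 0"
  using F.genideal_self[OF relators_subset] by (auto simp: cong_def quantum_matrix_ideal_def F_def)

lemma cong_iff_diff: "p \<approx> r \<longleftrightarrow> p - r \<approx> 0"
  by (simp add: cong_def)

text \<open>
  The relations, solved for the product in which the entry of the lower row comes first. This is the
  direction in which row \<open>i\<close> can be collected on the left.
\<close>

lemma commute_entries:
  assumes "i \<in> {1..N}" "j \<in> {1..N}" "c \<in> {1..N}" "d \<in> {1..N}" "i < j"
  shows "x j c * x i d \<approx>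
    (if d = c then inverse q \<bullet> (x i c * x j c)
     else if d < c then x i d * x j c - (q - inverse q) \<bullet> (x i c * x j d)
     else x i d * x j c)"
proof -
  have same: "x j c * x i c \<approx> inverse q \<bullet> (x i c * x j c)"
  proof -
    have "x i c * x j c - q \<bullet> (x j c * x i c) \<approx> 0"
      unfolding scale_def mult.assoc[symmetric]
      by (rule relator_cong_0, unfold quantum_matrix_relators_def Let_def,
          rule UnI1, rule UnI1, rule UnI1, insert assms, blast)
    from cong_scale[OF this, of "- inverse q"] show ?thesis
      using q_nonzero by (subst cong_iff_diff) (simp add: scale_diff_right scale_minus_left)
  qed
  have less: "x j c * x i d \<approx> x i d * x j c - (q - inverse q) \<bullet> (x i c * x j d)" if "d < c"
  proof -
    have "x i d * x j c - x j c * x i d - (q - inverse q) \<bullet> (x i c * x j d) \<approx> 0"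
      unfolding scale_def mult.assoc[symmetric]
      by (rule relator_cong_0, unfold quantum_matrix_relators_def Let_def,
          rule UnI2, insert assms that, blast)
    from cong_scale[OF this, of "- 1"] show ?thesis
      by (subst cong_iff_diff) (simp add: scale_minus_left algebra_simps)
  qed
  have greater: "x j c * x i d \<approx> x i d * x j c" if "c < d"
  proof -
    have "x i d * x j c - x j c * x i d \<approx> 0"
      by (rule relator_cong_0, unfold quantum_matrix_relators_def Let_def,
          rule UnI1, rule UnI2, insert assms that, blast)
    from cong_scale[OF this, of "- 1"] show ?thesis
      by (subst cong_iff_diff) (simp add: scale_minus_left)
  qed
  show ?thesis using same less greater by auto
qed

section \<open>Laplace expansion along a column\<close>

lemma minus_power_square: "(- a) ^ p * (- a) ^ p = a ^ (2 * p)" for a :: complex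
  by (simp add: mult_2 power_add flip: power_mult_distrib)

text \<open>
  Expanding along a column \<open>c\<close> that already belongs to \<open>C\<close> would give a minor with a repeated
  column, hence \<open>0\<close>. Otherwise the sign moves \<open>c\<close> from the front to its place among the columns.

  The proof is an induction on the rows. Write \<open>t = below C c\<close> and \<open>M\<close> for \<open>x i c\<close> times the minor of
  the remaining rows on the columns \<open>C\<close>. The row \<open>j = i\<close> contributes \<open>M\<close>. In all other terms the minor
  is expanded along row \<open>i\<close>, so that \<open>x j c * x i d\<close> appears for each \<open>d \<in> C\<close>. After commuting these
  entries, the induction hypothesis applies to the sum over \<open>j\<close> twice: for the column \<open>c\<close> it produces
  the terms of the expansion of the larger minor along row \<open>i\<close>, and for the column \<open>d\<close>, which comes
  from the correction term if \<open>d < c\<close>, it produces a multiple of \<open>M\<close> again. These multiples telescope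
  to \<open>q ^ (2 * t) - 1\<close>. Together with the \<open>M\<close> from row \<open>i\<close> this is the missing term \<open>d = c\<close> of the
  larger minor if \<open>c \<notin> C\<close>; if \<open>c \<in> C\<close>, it cancels against the term \<open>d = c\<close> that was already there.
\<close>

lemma column_expansion:
  assumes "sorted_wrt (<) is" and "set is \<subseteq> {1..N}" and "C \<subseteq> {1..N}" and "c \<in> {1..N}"
    and "Suc (card C) = length is"
  shows "(\<Sum>j\<in>set is. (- q) ^ below (set is) j \<bullet> (x j c * free_minor q x (remove1 j is) C))
    \<approx> (if c \<in> C then 0 else (- q) ^ below C c \<bullet> free_minor q x is (insert c C))"
  using assms
proof (induction "is" arbitrary: C c)
  case Nil
  then show ?case by simp
next
  case (Cons i "is")
  define R where "R = set is"
  have finC: "finite C" using Cons.prems(3) by (rule finite_subset) simp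
  have R: "i \<notin> R" "\<And>j. j \<in> R \<Longrightarrow> i < j" "finite R" "R \<subseteq> {1..N}"
    using Cons.prems by (auto simp: R_def)
  have i: "i \<in> {1..N}" and c: "c \<in> {1..N}" and CN: "\<And>d. d \<in> C \<Longrightarrow> d \<in> {1..N}"
    using Cons.prems by auto
  let ?m = "free_minor q x"
  \<comment> \<open>\<open>H e d\<close> is the expansion along column \<open>e\<close> in the rows below \<open>i\<close>, with \<open>d\<close> removed from \<open>C\<close>.\<close>
  define M where "M = x i c * ?m is C"
  define H where "H e d = (\<Sum>j\<in>R. (- q) ^ below R j \<bullet> (x j e * ?m (remove1 j is) (C - {d})))" for e d
  have H: "H e d \<approx> (if e \<in> C - {d} then 0
      else (- q) ^ below (C - {d}) e \<bullet> ?m is (insert e (C - {d})))"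
    if "d \<in> C" "e \<in> {1..N}" for d e
    unfolding H_def R_def
    using Cons.prems that card_Suc_Diff1[OF finC that(1)] by (intro Cons.IH) auto
  have Hd: "H d d \<approx> (- q) ^ below C d \<bullet> ?m is C" if "d \<in> C" for d
    using H[OF that, of d] that CN[OF that] by (simp add: insert_absorb)
  \<comment> \<open>\<open>(- q) ^ below C c\<close> times the term of column \<open>d\<close> in the expansion of the larger minor along row \<open>i\<close>, if \<open>c \<notin> C\<close>\<close>
  define A where "A d = (if c \<in> C then 0
    else (- q) ^ (below C c + below (insert c C) d) \<bullet> (x i d * ?m is (insert c C - {d})))" for d
  define T where "T d = (\<Sum>j\<in>R. ((- q) ^ Suc (below R j) * (- q) ^ below C d) \<bullet>
    (x j c * x i d * ?m (remove1 j is) (C - {d})))" for d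
  have split: "(\<Sum>j\<in>set (i # is). (- q) ^ below (set (i # is)) j \<bullet>
      (x j c * ?m (remove1 j (i # is)) C)) = M + (\<Sum>d\<in>C. T d)"
  proof -
    have "(\<Sum>j\<in>set (i # is). (- q) ^ below (set (i # is)) j \<bullet> (x j c * ?m (remove1 j (i # is)) C))
      = (- q) ^ below (insert i R) i \<bullet> M
        + (\<Sum>j\<in>R. (- q) ^ below (insert i R) j \<bullet> (x j c * ?m (remove1 j (i # is)) C))"
      using R by (simp add: R_def M_def)
    also have "below (insert i R) i = 0"
      using R by (intro below_less_eq_0) (auto intro: less_imp_le)
    also have "(\<Sum>j\<in>R. (- q) ^ below (insert i R) j \<bullet> (x j c * ?m (remove1 j (i # is)) C))
        = (\<Sum>j\<in>R. \<Sum>d\<in>C. ((- q) ^ Suc (below R j) * (- q) ^ below C d) \<bullet>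
            (x j c * x i d * ?m (remove1 j is) (C - {d})))"
    proof (rule sum.cong)
      fix j assume j: "j \<in> R"
      then have "below (insert i R) j = Suc (below R j)" "remove1 j (i # is) = i # remove1 j is"
        using R by (auto simp: below_insert)
      then show "(- q) ^ below (insert i R) j \<bullet> (x j c * ?m (remove1 j (i # is)) C)
        = (\<Sum>d\<in>C. ((- q) ^ Suc (below R j) * (- q) ^ below C d) \<bullet>
            (x j c * x i d * ?m (remove1 j is) (C - {d})))"
        by (simp add: sum_distrib_left scale_sum_right mult.assoc del: power_Suc)
    qed simp
    also have "\<dots> = (\<Sum>d\<in>C. T d)"
      unfolding T_def by (rule sum.swap)
    finally show ?thesis by simp
  qed
  have T: "T d \<approx> (- q) ^ Suc (below C d) \<bullet>
      (if d = c then inverse q \<bullet> (x i c * H c d)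
       else if d < c then x i d * H c d - (q - inverse q) \<bullet> (x i c * H d d)
       else x i d * H c d)" (is "_ \<approx> ?T'") if d: "d \<in> C" for d
  proof -
    have "T d \<approx> (\<Sum>j\<in>R. ((- q) ^ Suc (below R j) * (- q) ^ below C d) \<bullet>
      ((if d = c then inverse q \<bullet> (x i c * x j c)
        else if d < c then x i d * x j c - (q - inverse q) \<bullet> (x i c * x j d)
        else x i d * x j c) * ?m (remove1 j is) (C - {d})))"
      unfolding T_def
    proof (intro cong_sum cong_scale cong_mult_right commute_entries free_minor_closed)
      show "set (remove1 j is) \<subseteq> {1..N}" for j
        using set_remove1_subset[of j "is"] R(4) by (auto simp: R_def)
    qed (use i c d CN R Cons.prems in auto)
    also have "\<dots> = ?T'"
      unfolding H_def
      by (simp add: sum_distrib_left scale_sum_right scale_diff_right left_diff_distrib[where 'a = "(nat \<times> nat) ncpoly"]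
          sum_subtractf mult_ac(1) mult_ac(2,3)[where 'a = complex])
    finally show ?thesis .
  qed
  have V: "T d \<approx> (if d = c then (- (q ^ (2 * below C c))) \<bullet> M
      else if d < c then A d + (q ^ (2 * Suc (below C d)) - q ^ (2 * below C d)) \<bullet> M
      else A d)" if d: "d \<in> C" for d
  proof -
    have HM: "x i c * H d d \<approx> (- q) ^ below C d \<bullet> M"
      using cong_mult_left[OF Hd[OF d] x_closed[OF i c]] by (simp add: M_def)
    have HA: "(- q) ^ Suc (below C d) \<bullet> (x i d * H c d) \<approx> A d" if "d \<noteq> c"
    proof (cases "c \<in> C")
      case True
      then have "H c d \<approx> 0" using H[OF d c] \<open>d \<noteq> c\<close> by simp
      from cong_scale[OF cong_mult_left[OF this x_closed[OF i CN[OF d]]]]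
      show ?thesis using True by (simp add: A_def)
    next
      case False
      \<comment> \<open>Removing \<open>d\<close> lowers the position of \<open>c\<close> if \<open>d < c\<close>; inserting \<open>c\<close> raises that of \<open>d\<close> if \<open>c < d\<close>.\<close>
      have "Suc (below C d) + below (C - {d}) c = below C c + below (insert c C) d"
        using below_remove[OF finC d, of c] below_insert[OF finC False, of d] \<open>d \<noteq> c\<close> by auto
      then have pow: "(- q) ^ Suc (below C d) * (- q) ^ below (C - {d}) c
          = (- q) ^ (below C c + below (insert c C) d)"
        by (metis power_add)
      have set: "insert c (C - {d}) = insert c C - {d}" using \<open>d \<noteq> c\<close> by blast
      have "H c d \<approx> (- q) ^ below (C - {d}) c \<bullet> ?m is (insert c (C - {d}))"
        using H[OF d c] False by simp
      from cong_scale[OF cong_mult_left[OF this x_closed[OF i CN[OF d]]], of "(- q) ^ Suc (below C d)"]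
      show ?thesis using False by (simp add: A_def set pow del: power_Suc)
    qed
    consider "d = c" | "d < c" | "c < d" by linarith
    then show ?thesis
    proof cases
      case 1
      have "T d \<approx> (- q) ^ Suc (below C d) \<bullet> inverse q \<bullet> (x i c * H d d)"
        using T[OF d] 1 by simp
      also have "\<dots> \<approx> (- q) ^ Suc (below C d) \<bullet> inverse q \<bullet> (- q) ^ below C d \<bullet> M"
        by (intro cong_scale HM)
      also have "\<dots> = (- (q ^ (2 * below C c))) \<bullet> M"
      proof -
        have "(- q) ^ Suc (below C d) * inverse q * (- q) ^ below C d = - (q ^ (2 * below C c))"
        proof -
          have "(- q) ^ Suc (below C d) * inverse q * (- q) ^ below C d
              = - (q * inverse q) * ((- q) ^ below C d * (- q) ^ below C d)"
            by (simp add: mult_ac)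
          then show ?thesis using q_nonzero 1 by (simp add: minus_power_square)
        qed
        then show ?thesis by (simp add: mult.assoc)
      qed
      finally show ?thesis using 1 by simp
    next
      case 2
      have "T d \<approx> (- q) ^ Suc (below C d) \<bullet> (x i d * H c d)
          - ((- q) ^ Suc (below C d) * (q - inverse q)) \<bullet> (x i c * H d d)"
        using T[OF d] 2 by (simp add: scale_diff_right)
      also have "\<dots> \<approx> A d - ((- q) ^ Suc (below C d) * (q - inverse q)) \<bullet> (- q) ^ below C d \<bullet> M"
        using 2 by (intro cong_diff HA cong_scale HM) auto
      also have "\<dots> = A d + (q ^ (2 * Suc (below C d)) - q ^ (2 * below C d)) \<bullet> M"
      proof -
        have "- ((- q) ^ Suc (below C d) * (q - inverse q) * (- q) ^ below C d)
            = q ^ (2 * Suc (below C d)) - q ^ (2 * below C d)"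
        proof -
          have "- ((- q) ^ Suc (below C d) * (q - inverse q) * (- q) ^ below C d)
              = (q * q - q * inverse q) * ((- q) ^ below C d * (- q) ^ below C d)"
            by (simp add: algebra_simps)
          then show ?thesis
            using q_nonzero unfolding minus_power_square by (simp add: left_diff_distrib)
        qed
        then show ?thesis by (simp flip: scale_minus_left)
      qed
      finally show ?thesis using 2 by simp
    next
      case 3
      then show ?thesis using cong_trans[OF T[OF d]] HA by simp
    qed
  qed
  have "M + (\<Sum>d\<in>C. T d) \<approx> M + (\<Sum>d\<in>C. if d = c then (- (q ^ (2 * below C c))) \<bullet> M
      else if d < c then A d + (q ^ (2 * Suc (below C d)) - q ^ (2 * below C d)) \<bullet> M
      else A d)"
    by (intro cong_add cong_refl cong_sum V)
  also have "\<dots> = M + ((\<Sum>d\<in>C. if d = c then (- (q ^ (2 * below C c))) \<bullet> M else 0)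
      + (\<Sum>d\<in>C. if d < c then (q ^ (2 * Suc (below C d)) - q ^ (2 * below C d)) \<bullet> M else 0)
      + (\<Sum>d\<in>C. if d = c then 0 else A d))"
    unfolding sum.distrib[symmetric]
    by (intro arg_cong2[where f = "(+)"] refl sum.cong) auto
  also have "(\<Sum>d\<in>C. if d < c then (q ^ (2 * Suc (below C d)) - q ^ (2 * below C d)) \<bullet> M else 0)
      = (q ^ (2 * below C c) - 1) \<bullet> M"
    using sum_below_telescope[OF finC, of "\<lambda>p. q ^ (2 * p)" c]
    by (simp add: finC flip: sum.inter_filter scale_sum_left)
  also have "M + ((\<Sum>d\<in>C. if d = c then (- (q ^ (2 * below C c))) \<bullet> M else 0)
      + (q ^ (2 * below C c) - 1) \<bullet> M + (\<Sum>d\<in>C. if d = c then 0 else A d))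
    = (if c \<in> C then 0 else (- q) ^ below C c \<bullet> ?m (i # is) (insert c C))"
  proof (cases "c \<in> C")
    case True
    then have "A d = 0" for d by (simp add: A_def)
    then have "(\<Sum>d\<in>C. if d = c then 0 else A d) = 0" by (simp add: sum.neutral)
    moreover have "M + ((- (q ^ (2 * below C c))) \<bullet> M + (q ^ (2 * below C c) - 1) \<bullet> M) = 0"
      unfolding scale_add_left[symmetric] by (simp add: scale_minus_left)
    ultimately show ?thesis using True finC by (simp add: add.assoc)
  next
    case False
    have "M + (q ^ (2 * below C c) - 1) \<bullet> M = q ^ (2 * below C c) \<bullet> M"
      using scale_add_left[of 1 "q ^ (2 * below C c) - 1" M] by simp
    moreover have "(\<Sum>d\<in>C. if d = c then 0 else A d) = (\<Sum>d\<in>C. A d)"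
      using False by (intro sum.cong) auto
    moreover have "(\<Sum>d\<in>C. if d = c then (- (q ^ (2 * below C c))) \<bullet> M else 0) = 0"
      using False by (intro sum.neutral) auto
    moreover have "(- q) ^ below C c \<bullet> ?m (i # is) (insert c C) = q ^ (2 * below C c) \<bullet> M + (\<Sum>d\<in>C. A d)"
      using False finC
      by (simp add: A_def M_def scale_add_right scale_sum_right power_add power_mult
          power2_eq_square flip: power_mult_distrib)
    ultimately show ?thesis using False by (simp flip: add.assoc)
  qed
  finally show ?case unfolding split .
qed

section \<open>The Pfaffian of the entries z as a sum of minors\<close>

definition block_minor :: "nat \<Rightarrow> nat \<Rightarrow> nat \<Rightarrow> (nat \<times> nat) ncpoly" where
  "block_minor k i j = x i (2 * k - 1) * x j (2 * k) - q \<bullet> (x i (2 * k) * x j (2 * k - 1))"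

definition free_zL :: "nat \<Rightarrow> complex \<Rightarrow> nat \<Rightarrow> nat \<Rightarrow> (nat \<times> nat) ncpoly" where
  "free_zL n s i j = (\<Sum>k\<in>{1..n}. s powi (int i + int j + 1 - 4 * int k) \<bullet> block_minor k i j)"

lemma block_minor_closed:
  assumes "N = 2 * n" "k \<in> {1..n}" "i \<in> {1..N}" "j \<in> {1..N}"
  shows "block_minor k i j \<in> carrier F"
  unfolding block_minor_def using assms
  by (intro diff_closed scale_closed mult_closed x_closed) auto

lemma free_zL_closed:
  assumes "N = 2 * n" "i \<in> {1..N}" "j \<in> {1..N}"
  shows "free_zL n s i j \<in> carrier F"
  unfolding free_zL_def using assms
  by (intro sum_closed scale_closed block_minor_closed) auto

text \<open>
  The terms of the column pair \<open>k\<close> in the expansion of a minor along its first row \<open>i\<close>.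
\<close>

definition row_block ::
  "nat \<Rightarrow> nat list \<Rightarrow> nat \<Rightarrow> nat set \<Rightarrow> (nat \<times> nat) ncpoly" where
  "row_block i is k C =
    (\<Sum>c\<in>{2 * k - 1, 2 * k}. (- q) ^ below C c \<bullet> (x i c * free_minor q x is (C - {c})))"

lemma free_minor_block_columns:
  assumes "K \<subseteq> {1..n}"
  shows "free_minor q x (i # is) (block_columns K)
    = (\<Sum>k\<in>K. row_block i is k (block_columns K))"
  unfolding free_minor.simps row_block_def
  using assms finite_subset[OF assms]
  by (subst block_columns_def, subst sum.UNION_disjoint) fastforce+

text \<open>
  Each of the two summands of \<open>block_minor k i j\<close> yields one Laplace expansion, along the columns
  \<open>2 * k\<close> and \<open>2 * k - 1\<close>. If \<open>k \<in> K\<close>, both have a repeated column. If \<open>k \<notin> K\<close>, both columns have the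
  same number of columns of \<open>K\<close> below them, and the factor \<open>- q\<close> of the second summand accounts for
  the position of \<open>2 * k\<close> behind \<open>2 * k - 1\<close>.
\<close>

lemma block_minor_expansion:
  assumes N: "N = 2 * n" and "sorted_wrt (<) is" and "set is \<subseteq> {1..N}" and i: "i \<in> {1..N}"
    and K: "K \<subseteq> {1..n}" and k: "k \<in> {1..n}" and "length is = Suc (2 * card K)"
  shows "(\<Sum>j\<in>set is. (- q) ^ below (set is) j \<bullet>
      (block_minor k i j * free_minor q x (remove1 j is) (block_columns K)))
    \<approx> (if k \<in> K then 0 else row_block i is k (block_columns (insert k K)))"
proof -
  let ?C = "block_columns K" and ?a = "2 * k - 1" and ?b = "2 * k"
  let ?L = "\<lambda>c. \<Sum>j\<in>set is. (- q) ^ below (set is) j \<bullet>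
    (x j c * free_minor q x (remove1 j is) ?C)"
  let ?E = "\<lambda>c. if c \<in> ?C then 0 else (- q) ^ below ?C c \<bullet> free_minor q x is (insert c ?C)"
  have ab: "?a \<in> {1..N}" "?b \<in> {1..N}" using k N by auto
  have C: "?C \<subseteq> {1..N}" "finite ?C"
    using block_columns_subset[OF K] N finite_subset by auto
  have L: "?L c \<approx> ?E c" if "c \<in> {1..N}" for c
    using assms C that card_block_columns[OF K] by (intro column_expansion) auto
  have "(\<Sum>j\<in>set is. (- q) ^ below (set is) j \<bullet>
      (block_minor k i j * free_minor q x (remove1 j is) ?C)) = x i ?a * ?L ?b - q \<bullet> (x i ?b * ?L ?a)"
    by (simp add: block_minor_def left_diff_distrib scale_diff_right sum_subtractf
        sum_distrib_left scale_sum_right mult.assoc mult.commute)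
  also have "\<dots> \<approx> x i ?a * ?E ?b - q \<bullet> (x i ?b * ?E ?a)"
    by (intro cong_diff cong_scale cong_mult_left L x_closed i ab)
  also have "\<dots> = (if k \<in> K then 0 else row_block i is k (block_columns (insert k K)))"
  proof (cases "k \<in> K")
    case True
    then show ?thesis using in_block_columns_iff[OF K, of k] k by simp
  next
    case False
    have notin: "?a \<notin> ?C" "?b \<notin> ?C" "?a \<noteq> ?b"
      using in_block_columns_iff[OF K, of k] k False by auto
    have ins: "block_columns (insert k K) = insert ?a (insert ?b ?C)"
      by (auto simp: block_columns_def)
    have less: "?a < ?b" using k by auto
    have "{d \<in> ?C. d < ?b} = {d \<in> ?C. d < ?a}"
      using notin less by (auto simp: less_Suc_eq) (metis One_nat_def Suc_pred less_antisym less_imp_Suc_add zero_less_Suc)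
    then have ba: "below ?C ?b = below ?C ?a" by (simp add: below_def)
    have "below (insert ?a (insert ?b ?C)) ?a = below ?C ?a"
      using below_insert[of ?C ?b ?a] C notin less by simp
    moreover have "below (insert ?a (insert ?b ?C)) ?b = Suc (below ?C ?a)"
      using below_insert[of "insert ?b ?C" ?a ?b] C notin less ba by simp
    moreover have "insert ?a (insert ?b ?C) - {?a} = insert ?b ?C"
      "insert ?a (insert ?b ?C) - {?b} = insert ?a ?C"
      using notin by auto
    ultimately show ?thesis
      using False notin ba by (simp add: row_block_def ins scale_minus_left)
  qed
  finally show ?thesis .
qed

text \<open>
  The factor \<open>s ^ (i + j + 1)\<close> of \<open>free_zL n s i j\<close> depends on the rows only, and a pairing uses each row
  once, so these factors combine to \<open>s ^ (\<Sum> (set is) + m)\<close> for every pairing. What remains of the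
  exponent is the weight \<open>inverse (q ^ (2 * k))\<close> of the column pair \<open>k\<close>, because \<open>s ^ 4 = q ^ 2\<close>.
\<close>

lemma free_pfaffian_cong:
  assumes N: "N = 2 * n" and s: "s ^ 2 = q"
    and "sorted_wrt (<) is" and "set is \<subseteq> {1..N}" and "length is = 2 * m"
  shows "free_pfaffian q (free_zL n s) (set is) \<approx> s ^ (\<Sum> (set is) + m) \<bullet>
    (\<Sum>K | K \<subseteq> {1..n} \<and> card K = m.
      (\<Prod>k\<in>K. inverse (q ^ (2 * k))) \<bullet> free_minor q x is (block_columns K))"
  using assms(3-)
proof (induction m arbitrary: "is")
  case 0
  have "{K. K \<subseteq> {1..n} \<and> card K = 0} = {{}}"
    using finite_subset[of _ "{1..n}"] by auto
  then show ?case using 0 by (simp add: free_pfaffian_empty del: card_0_eq)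
next
  case (Suc m)
  obtain i rs where eq: "is = i # rs" using Suc.prems by (cases "is") auto
  define R where "R = set rs"
  have R: "finite R" "\<And>j. j \<in> R \<Longrightarrow> i < j" "i \<notin> R" "R \<subseteq> {1..N}" "distinct rs" "sorted_wrt (<) rs"
    and i: "i \<in> {1..N}"
    using Suc.prems by (auto simp: eq R_def strict_sorted_iff)
  have s0: "s \<noteq> 0" using s q_nonzero by auto
  define w where "w k = inverse (q ^ (2 * k))" for k
  let ?P = "\<lambda>m. {K. K \<subseteq> {1..n} \<and> card K = m}"
  let ?m = "free_minor q x"
  have fin: "finite K" if "K \<subseteq> {1..n}" for K :: "nat set"
    using that by (rule finite_subset) simp
  \<comment> \<open>Splits the exponent of \<open>s\<close> into its row part and its column part.\<close>
  have z: "free_zL n s i j = s ^ (i + j + 1) \<bullet> (\<Sum>k\<in>{1..n}. w k \<bullet> block_minor k i j)" for j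
  proof -
    have "s powi (int i + int j + 1 - 4 * int k) = s ^ (i + j + 1) * w k" for k
    proof -
      have "s powi (int i + int j + 1 - 4 * int k) = s powi int (i + j + 1) / s powi int (4 * k)"
        using s0 by (subst power_int_diff[symmetric]) (auto simp: add_ac)
      also have "s powi int (i + j + 1) = s ^ (i + j + 1)"
        by (rule power_int_of_nat)
      also have "s powi int (4 * k) = q ^ (2 * k)"
        unfolding power_int_of_nat s[symmetric] power_mult[symmetric] by simp
      finally show ?thesis by (simp add: w_def field_simps)
    qed
    then show ?thesis by (simp add: free_zL_def scale_sum_right)
  qed
  have "free_pfaffian q (free_zL n s) (set is) = (\<Sum>j\<in>R. (- q) ^ below R j \<bullet>
      (free_zL n s i j * free_pfaffian q (free_zL n s) (R - {j})))"
    using free_pfaffian_insert[OF R(1,2)] by (simp add: eq R_def)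
  also have "\<dots> \<approx> (\<Sum>j\<in>R. (- q) ^ below R j \<bullet> (free_zL n s i j *
      (s ^ (\<Sum> (R - {j}) + m) \<bullet> (\<Sum>K\<in>?P m. prod w K \<bullet> ?m (remove1 j rs) (block_columns K)))))"
  proof (intro cong_sum cong_scale cong_mult_left free_zL_closed[OF N] i)
    fix j assume j: "j \<in> R"
    have set: "set (remove1 j rs) = R - {j}" using R by (simp add: R_def)
    have "sorted_wrt (<) (remove1 j rs)"
      using R by (simp add: strict_sorted_iff sorted_remove1)
    moreover have "length (remove1 j rs) = 2 * m"
      using j Suc.prems(3) by (simp add: eq R_def length_remove1)
    moreover have "set (remove1 j rs) \<subseteq> {1..N}" using R(4) unfolding set by blast
    ultimately show "free_pfaffian q (free_zL n s) (R - {j}) \<approx> s ^ (\<Sum> (R - {j}) + m) \<bullet>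
        (\<Sum>K\<in>?P m. prod w K \<bullet> ?m (remove1 j rs) (block_columns K))"
      using Suc.IH[of "remove1 j rs"] by (simp add: set w_def)
    show "j \<in> {1..N}" using j R(4) by blast
  qed
  also have "\<dots> = (\<Sum>j\<in>R. s ^ (\<Sum> (set is) + Suc m) \<bullet> (\<Sum>K\<in>?P m. \<Sum>k\<in>{1..n}. (prod w K * w k) \<bullet>
      (- q) ^ below R j \<bullet> (block_minor k i j * ?m (remove1 j rs) (block_columns K))))"
  proof (rule sum.cong)
    fix j assume j: "j \<in> R"
    have "\<Sum> (set is) = i + (j + \<Sum> (R - {j}))"
      using R j by (simp add: eq R_def[symmetric] sum.remove[of R j])
    then have pow: "s ^ (\<Sum> (set is) + Suc m) = s ^ (i + j + 1) * s ^ (\<Sum> (R - {j}) + m)"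
      by (simp add: power_add mult_ac)
    show "(- q) ^ below R j \<bullet> (free_zL n s i j *
      (s ^ (\<Sum> (R - {j}) + m) \<bullet> (\<Sum>K\<in>?P m. prod w K \<bullet> ?m (remove1 j rs) (block_columns K))))
      = s ^ (\<Sum> (set is) + Suc m) \<bullet> (\<Sum>K\<in>?P m. \<Sum>k\<in>{1..n}. (prod w K * w k) \<bullet>
      (- q) ^ below R j \<bullet> (block_minor k i j * ?m (remove1 j rs) (block_columns K)))"
      unfolding z pow
      by (simp add: sum_distrib_left sum_distrib_right scale_sum_right mult_ac)
  qed simp
  also have "\<dots> = s ^ (\<Sum> (set is) + Suc m) \<bullet> (\<Sum>K\<in>?P m. \<Sum>k\<in>{1..n}. (prod w K * w k) \<bullet>
      (\<Sum>j\<in>R. (- q) ^ below R j \<bullet> (block_minor k i j * ?m (remove1 j rs) (block_columns K))))"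
    by (simp only: scale_sum_right, subst sum.swap, rule sum.cong[OF refl], rule sum.swap)
  also have "\<dots> \<approx> s ^ (\<Sum> (set is) + Suc m) \<bullet> (\<Sum>K\<in>?P m. \<Sum>k\<in>{1..n}. (prod w K * w k) \<bullet>
      (if k \<in> K then 0 else row_block i rs k (block_columns (insert k K))))"
  proof (intro cong_scale cong_sum)
    fix K k assume "K \<in> ?P m" "k \<in> {1..n}"
    then show "(\<Sum>j\<in>R. (- q) ^ below R j \<bullet> (block_minor k i j * ?m (remove1 j rs) (block_columns K)))
      \<approx> (if k \<in> K then 0 else row_block i rs k (block_columns (insert k K)))"
      unfolding R_def using Suc.prems i
      by (intro block_minor_expansion[OF N]) (auto simp: eq)
  qed
  also have "(\<Sum>K\<in>?P m. \<Sum>k\<in>{1..n}. (prod w K * w k) \<bullet>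
      (if k \<in> K then 0 else row_block i rs k (block_columns (insert k K))))
    = (\<Sum>K\<in>?P m. \<Sum>k\<in>{1..n} - K. prod w (insert k K) \<bullet> row_block i rs k (block_columns (insert k K)))"
  proof (rule sum.cong[OF refl], rule sum.mono_neutral_cong_right)
    fix K k assume "K \<in> ?P m" "k \<in> {1..n} - K"
    then show "(prod w K * w k) \<bullet> (if k \<in> K then 0 else row_block i rs k (block_columns (insert k K)))
      = prod w (insert k K) \<bullet> row_block i rs k (block_columns (insert k K))"
      using fin[of K] by (simp add: mult.commute)
  qed auto
  also have "\<dots> = (\<Sum>K\<in>?P (Suc m). \<Sum>k\<in>K. prod w K \<bullet> row_block i rs k (block_columns K))"
    by (rule sum_subsets_insert)
  also have "\<dots> = (\<Sum>K\<in>?P (Suc m). prod w K \<bullet> ?m is (block_columns K))"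
  proof (rule sum.cong)
    fix K assume "K \<in> ?P (Suc m)"
    then show "(\<Sum>k\<in>K. prod w K \<bullet> row_block i rs k (block_columns K)) = prod w K \<bullet> ?m is (block_columns K)"
      unfolding eq by (subst free_minor_block_columns[of K n]) (auto simp: scale_sum_right)
  qed simp
  finally show ?case by (simp add: w_def)
qed

text \<open>
  The exponent of \<open>s\<close> is \<open>n * (2 * n + 1) + n = 2 * (n * (n + 1))\<close>, and \<open>n * (n + 1)\<close> is the sum of the
  exponents \<open>2 * k\<close> of the weights.
\<close>

lemma free_pfaffian_cong_minor:
  assumes N: "N = 2 * n" and s: "s ^ 2 = q"
  shows "free_pfaffian q (free_zL n s) {1..N} \<approx> free_minor q x [1..<N + 1] {1..N}"
proof -
  have set: "set [1..<N + 1] = {1..N}" by auto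
  have "{K. K \<subseteq> {1..n} \<and> card K = n} = {{1..n}}"
    using card_subset_eq[of "{1..n}"] by auto
  moreover have "s ^ (\<Sum> {1..N} + n) * (\<Prod>k\<in>{1..n}. inverse (q ^ (2 * k))) = 1"
  proof -
    have "\<Sum> {1..N} + n = 2 * (\<Sum>k\<in>{1..n}. 2 * k)"
      unfolding N by (induction n) auto
    then have "s ^ (\<Sum> {1..N} + n) = s ^ (2 * (\<Sum>k\<in>{1..n}. 2 * k))"
      by (rule arg_cong)
    also have "\<dots> = (\<Prod>k\<in>{1..n}. q ^ (2 * k))"
      unfolding power_mult[of s] s by (rule power_sum)
    finally show ?thesis
      using q_nonzero prod_inversef[of "\<lambda>k. q ^ (2 * k)" "{1..n}"] by (simp add: comp_def)
  qed
  moreover have "free_pfaffian q (free_zL n s) (set [1..<N + 1]) \<approx> s ^ (\<Sum> (set [1..<N + 1]) + n) \<bullet>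
    (\<Sum>K | K \<subseteq> {1..n} \<and> card K = n.
      (\<Prod>k\<in>K. inverse (q ^ (2 * k))) \<bullet> free_minor q x [1..<N + 1] (block_columns K))"
    by (rule free_pfaffian_cong[OF N s]) (auto simp: N sorted_wrt_upt simp del: upt_Suc)
  moreover have "block_columns {1..n} = {1..N}"
    by (simp only: block_columns_all N)
  ultimately show ?thesis
    unfolding set by (simp del: upt_Suc One_nat_def)
qed

section \<open>Passage to the quotient algebra\<close>

abbreviation "A \<equiv> quantum_matrix_algebra N q"

definition coset :: "(nat \<times> nat) ncpoly \<Rightarrow> qmat" where
  "coset p = quantum_matrix_ideal N q +>\<^bsub>F\<^esub> p"

lemma A_eq: "A = quotient_algebra F (quantum_matrix_ideal N q)"
  by (simp add: quantum_matrix_algebra_def F_def)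

sublocale A: abelian_group A
  unfolding A_eq by (rule abelian_group_quotient_algebra[OF J.quotient_is_ring])

lemma coset_closed: "p \<in> carrier F \<Longrightarrow> coset p \<in> carrier A"
  using ring_hom_closed[OF J.rcos_ring_hom] by (simp add: A_eq quotient_algebra_ops coset_def)

lemma coset_mult: "p \<in> carrier F \<Longrightarrow> r \<in> carrier F \<Longrightarrow> coset p \<otimes>\<^bsub>A\<^esub> coset r = coset (p * r)"
  using ring_hom_mult[OF J.rcos_ring_hom] by (simp add: A_eq quotient_algebra_ops coset_def F_ops)

lemma coset_add: "p \<in> carrier F \<Longrightarrow> r \<in> carrier F \<Longrightarrow> coset p \<oplus>\<^bsub>A\<^esub> coset r = coset (p + r)"
  using ring_hom_add[OF J.rcos_ring_hom] by (simp add: A_eq quotient_algebra_ops coset_def F_ops)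

lemma coset_one: "\<one>\<^bsub>A\<^esub> = coset 1"
  using ring_hom_one[OF J.rcos_ring_hom] by (simp add: A_eq quotient_algebra_ops coset_def F_ops)

lemma coset_zero: "\<zero>\<^bsub>A\<^esub> = coset 0"
  by (simp add: A_eq quotient_algebra_ops coset_def F_ops FactRing_def a_r_coset_def')

lemma cong_imp_coset_eq:
  assumes "p \<approx> r" "p \<in> carrier F" "r \<in> carrier F"
  shows "coset p = coset r"
proof -
  have "p \<in> quantum_matrix_ideal N q +>\<^bsub>F\<^esub> r"
    using assms(1) unfolding a_r_coset_def' cong_def
    by (auto simp: F_ops intro!: bexI[of _ "p - r"])
  then show ?thesis
    unfolding coset_def using J.a_repr_independence'[of p r] assms(3) by simp
qed

text \<open>
  Scalar multiplication in the quotient is a union over all representatives of a coset. Each of them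
  gives the same coset.
\<close>

lemma coset_scale:
  assumes p: "p \<in> carrier F"
  shows "c \<odot>\<^bsub>A\<^esub> coset p = coset (c \<bullet> p)"
proof -
  have "coset (c \<bullet> a) = coset (c \<bullet> p)" if a: "a \<in> coset p" for a
  proof -
    obtain h where h: "h \<in> quantum_matrix_ideal N q" "a = h + p"
      using a by (auto simp: coset_def a_r_coset_def' F_ops)
    then have "a \<in> carrier F" using J.Icarr p by blast
    then show ?thesis
      using h p by (intro cong_imp_coset_eq cong_scale scale_closed) (simp_all add: cong_def)
  qed
  moreover have "p \<in> coset p"
    unfolding coset_def using p by (rule J.a_rcos_self)
  ultimately show ?thesis
    unfolding A_eq quotient_algebra_ops F_ops coset_def[symmetric] by blast
qed

lemma coset_diff:
  assumes "p \<in> carrier F" "r \<in> carrier F"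
  shows "coset p \<ominus>\<^bsub>A\<^esub> coset r = coset (p - r)"
proof -
  have nr: "- r \<in> carrier F" using scale_closed[OF assms(2), of "- 1"] by (simp add: scale_minus_left)
  have "\<ominus>\<^bsub>A\<^esub> coset r = coset (- r)"
    using assms nr by (intro A.minus_equality) (simp_all add: coset_closed coset_add coset_zero)
  then show ?thesis
    using assms nr by (simp add: a_minus_def coset_add)
qed

lemma coset_sum:
  assumes "finite S" "\<And>a. a \<in> S \<Longrightarrow> f a \<in> carrier F" "\<And>a. a \<in> S \<Longrightarrow> g a = coset (f a)"
  shows "(\<Oplus>\<^bsub>A\<^esub>a\<in>S. g a) = coset (\<Sum>a\<in>S. f a)"
  using assms
proof (induction S rule: finite_induct)
  case empty
  then show ?case by (simp add: coset_zero)
next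
  case (insert a S)
  have "g b \<in> carrier A" if "b \<in> insert a S" for b
    unfolding insert.prems(2)[OF that] by (rule coset_closed[OF insert.prems(1)[OF that]])
  then have "g \<in> S \<rightarrow> carrier A" "g a \<in> carrier A" by auto
  then have "(\<Oplus>\<^bsub>A\<^esub>a\<in>insert a S. g a) = g a \<oplus>\<^bsub>A\<^esub> (\<Oplus>\<^bsub>A\<^esub>a\<in>S. g a)"
    using insert.hyps by (rule A.finsum_insert[rotated 2])
  also have "\<dots> = coset (f a) \<oplus>\<^bsub>A\<^esub> coset (\<Sum>a\<in>S. f a)"
    using insert by simp
  also have "\<dots> = coset (\<Sum>a\<in>insert a S. f a)"
    using insert.prems insert.hyps by (subst coset_add) (auto intro!: sum_closed)
  finally show ?case .
qed

lemma prod_list_closed: "(\<And>a. a \<in> set xs \<Longrightarrow> f a \<in> carrier F) \<Longrightarrow> prod_list (map f xs) \<in> carrier F"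
  by (induction xs) auto

lemma coset_prod_list:
  assumes "\<And>a. a \<in> set xs \<Longrightarrow> f a \<in> carrier F" "\<And>a. a \<in> set xs \<Longrightarrow> g a = coset (f a)"
  shows "list_prod A (map g xs) = coset (prod_list (map f xs))"
  using assms
proof (induction xs)
  case Nil
  then show ?case by (simp add: list_prod_def coset_one)
next
  case (Cons a xs)
  then have "list_prod A (map g xs) = coset (prod_list (map f xs))" by simp
  then show ?case
    using Cons.prems coset_mult[of "f a" "prod_list (map f xs)"] prod_list_closed[of xs f]
    by (simp add: list_prod_def)
qed

abbreviation "X \<equiv> quantum_matrix_gen N q"

lemma X_eq: "X i j = coset (x i j)"
  by (simp add: quantum_matrix_gen_def coset_def F_def)

lemma quantum_det_eq_coset: "quantum_det A N q X = coset (free_minor q x [1..<N + 1] {1..N})"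
proof -
  have closed: "prod_list (map (\<lambda>i. x i (\<sigma> i)) [1..<N + 1]) \<in> carrier F"
    and eq: "list_prod A (map (\<lambda>i. X i (\<sigma> i)) [1..<N + 1])
      = coset (prod_list (map (\<lambda>i. x i (\<sigma> i)) [1..<N + 1]))"
    if "\<sigma> permutes {1..N}" for \<sigma>
  proof -
    have "x i (\<sigma> i) \<in> carrier F" if "i \<in> set [1..<N + 1]" for i
    proof (rule x_closed)
      show i: "i \<in> {1..N}" using that by auto
      show "\<sigma> i \<in> {1..N}" using permutes_in_image[OF \<open>\<sigma> permutes {1..N}\<close>] i by blast
    qed
    then show "prod_list (map (\<lambda>i. x i (\<sigma> i)) [1..<N + 1]) \<in> carrier F"
      "list_prod A (map (\<lambda>i. X i (\<sigma> i)) [1..<N + 1])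
      = coset (prod_list (map (\<lambda>i. x i (\<sigma> i)) [1..<N + 1]))"
      by (intro prod_list_closed coset_prod_list; simp add: X_eq del: upt_Suc)+
  qed
  show ?thesis
    unfolding quantum_det_def free_minor_eq_sum_permutes
  proof (rule coset_sum)
    fix \<sigma> assume "\<sigma> \<in> {\<sigma>. \<sigma> permutes {1..N}}"
    then have \<sigma>: "\<sigma> permutes {1..N}" by simp
    show "(- q) ^ inversions N \<sigma> \<bullet> prod_list (map (\<lambda>i. x i (\<sigma> i)) [1..<N + 1]) \<in> carrier F"
      by (rule scale_closed[OF closed[OF \<sigma>]])
    show "(- q) ^ inversions N \<sigma> \<odot>\<^bsub>A\<^esub> list_prod A (map (\<lambda>i. X i (\<sigma> i)) [1..<N + 1])
      = coset ((- q) ^ inversions N \<sigma> \<bullet> prod_list (map (\<lambda>i. x i (\<sigma> i)) [1..<N + 1]))"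
      unfolding eq[OF \<sigma>] by (rule coset_scale[OF closed[OF \<sigma>]])
  qed (simp add: finite_permutations)
qed

lemma zL_eq_coset:
  assumes N: "N = 2 * n" and ij: "i \<in> {1..N}" "j \<in> {1..N}"
  shows "zL A n q s X i j = coset (free_zL n s i j)"
  unfolding zL_def free_zL_def
proof (rule coset_sum)
  fix k assume k: "k \<in> {1..n}"
  then have "2 * k - 1 \<in> {1..N}" "2 * k \<in> {1..N}" using N by auto
  then have closed: "x i' (2 * k - 1) \<in> carrier F" "x i' (2 * k) \<in> carrier F" if "i' \<in> {i, j}" for i'
    using ij that by (auto intro: x_closed)
  have closed: "x i (2 * k - 1) * x j (2 * k) \<in> carrier F" "x i (2 * k) * x j (2 * k - 1) \<in> carrier F"
    and "X i (2 * k - 1) \<otimes>\<^bsub>A\<^esub> X j (2 * k) = coset (x i (2 * k - 1) * x j (2 * k))"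
      "X i (2 * k) \<otimes>\<^bsub>A\<^esub> X j (2 * k - 1) = coset (x i (2 * k) * x j (2 * k - 1))"
    using closed by (auto simp: X_eq coset_mult)
  then show "s powi (int i + int j + 1 - 4 * int k) \<odot>\<^bsub>A\<^esub>
      (X i (2 * k - 1) \<otimes>\<^bsub>A\<^esub> X j (2 * k) \<ominus>\<^bsub>A\<^esub>
        q \<odot>\<^bsub>A\<^esub> (X i (2 * k) \<otimes>\<^bsub>A\<^esub> X j (2 * k - 1)))
    = coset (s powi (int i + int j + 1 - 4 * int k) \<bullet> block_minor k i j)"
    by (simp add: block_minor_def coset_scale coset_diff scale_closed diff_closed)
  show "s powi (int i + int j + 1 - 4 * int k) \<bullet> block_minor k i j \<in> carrier F"
    using block_minor_closed[OF N k ij] by (rule scale_closed)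
qed simp

lemma quantum_pfaffian_eq_coset:
  assumes N: "N = 2 * n"
  shows "quantum_pfaffian A n q (zL A n q s X) = coset (free_pfaffian q (free_zL n s) {1..N})"
    and "free_pfaffian q (free_zL n s) {1..N} \<in> carrier F"
proof -
  let ?z = "free_zL n s"
  have mem: "i \<in> {1..N} \<and> j \<in> {1..N}" if "\<pi> \<in> two_partitions n" "(i, j) \<in> set \<pi>" for \<pi> i j
    using that set_pairs_subset_flatten_pairs[of \<pi>] N by (auto simp: two_partitions_def)
  have closed: "prod_list (map (\<lambda>(i, j). ?z i j) \<pi>) \<in> carrier F"
    and eq: "list_prod A (map (\<lambda>(i, j). zL A n q s X i j) \<pi>)
      = coset (prod_list (map (\<lambda>(i, j). ?z i j) \<pi>))"
    if "\<pi> \<in> two_partitions n" for \<pi>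
    using mem[OF that]
    by (auto intro!: prod_list_closed coset_prod_list free_zL_closed[OF N] zL_eq_coset[OF N])
  have fin: "finite (two_partitions n)"
    unfolding two_partitions_eq_pairings by (rule finite_pairings) simp
  show "quantum_pfaffian A n q (zL A n q s X) = coset (free_pfaffian q ?z {1..N})"
    unfolding N[THEN arg_cong, of "\<lambda>N. {1..N}"] free_pfaffian_eq_sum_two_partitions quantum_pfaffian_def
    by (rule coset_sum) (auto simp: fin eq coset_scale closed intro!: scale_closed)
  show "free_pfaffian q ?z {1..N} \<in> carrier F"
    unfolding N[THEN arg_cong, of "\<lambda>N. {1..N}"] free_pfaffian_eq_sum_two_partitions
    using closed by (intro sum_closed scale_closed)
qed

lemma quantum_pfaffian_eq_quantum_det:
  assumes "N = 2 * n" and "s ^ 2 = q"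
  shows "quantum_pfaffian A n q (zL A n q s X) = quantum_det A N q X"
  unfolding quantum_pfaffian_eq_coset(1)[OF assms(1)] quantum_det_eq_coset
proof (rule cong_imp_coset_eq)
  show "free_minor q x [1..<N + 1] {1..N} \<in> carrier F"
    by (rule free_minor_closed) auto
qed (use assms free_pfaffian_cong_minor quantum_pfaffian_eq_coset(2) in auto)

end

theorem theorem3p2:
  fixes q s :: complex and n :: nat
  assumes "q \<noteq> 0"
    and "q = 1 \<or> (\<forall>m::nat. m \<ge> 1 \<longrightarrow> q ^ m \<noteq> 1)"
    and "s ^ 2 = q"
    and "n \<ge> 1"
  defines "A \<equiv> quantum_matrix_algebra (2 * n) q"
    and "x \<equiv> quantum_matrix_gen (2 * n) q"
  shows "quantum_pfaffian A n q (zL A n q s x) = quantum_det A (2 * n) q x"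
proof -
  interpret quantum_matrices "2 * n" q
    by standard (rule assms(1))
  show ?thesis
    unfolding A_def x_def using assms(3) by (intro quantum_pfaffian_eq_quantum_det) simp_all
qed

end
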